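(* Let $1<\alpha\le 2$, $\eta\in(0,1)$, $\beta>0$, let $f:[0,1]\times\mathbb{R}\to[0,\infty)$ be continuous, and let $H_1,H_2:C[0,1]\to[0,\infty)$ be compact functionals. Assume $\beta<\min\{\beta_K,\beta_\gamma\}$ and fix $b$ with $\eta\le b<t^*$. Let $\rho>0$ and assume that: (1) there exists $\underline{\delta}_\rho\in C([0,b],\mathbb{R}^+)$ such that $f(t,u)\ge\underline{\delta}_\rho(t)$ for all $(t,u)\in[0,b]\times[\sigma_3\rho,\rho]$; (2) there exist $\eta_{1,\rho},\eta_{2,\rho}\ge 0$ such that $H_1[u]\ge\eta_{1,\rho}$ and $H_2[u]\ge\eta_{2,\rho}$ for every $u\in P_{\sigma_3}\cap\partial\Omega_\rho$; (3) the inequality $$\gamma(0)\,\eta_{1,\rho}+\eta_{2,\rho}+\int_0^bK(0,s)\,\underline{\delta}_\rho(s)\,ds>0$$ holds. Then there exist $\lambda_\rho>0$ and $u_\rho\in P_{\sigma_3}\cap\partial\Omega_\rho$ such that the couple $(\lambda_\rho,u_\rho)$ solves (in the mild sense) the boundary value problem $$\begin{cases}{}^{C}D^{\alpha}u(t)+\lambda f(t,u(t))=0,\quad t\in(0,1),\\ u'(0)+\lambda H_1[u]=0,\\ \beta\,{}^{C}D^{\alpha-1}u(1)+u(\eta)=\lambda H_2[u],\end{cases}$$ and $\sigma_3\rho\le u_\rho(t)\le\rho$ for every $t\in[0,b]$.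
   Context: $C[0,1]$ carries the supremum norm $\|\cdot\|_\infty$; $\Omega_\rho=\{u\in C[0,1]:\|u\|_\infty<\rho\}$, with boundary $\partial\Omega_\rho=\{u:\|u\|_\infty=\rho\}$. $\mathbb{R}^+=[0,\infty)$. $\Gamma$ is the Gamma function and ${}^{C}D^{\alpha}$ the Caputo fractional derivative of order $\alpha$. "Compact" means continuous and mapping bounded sets to relatively compact sets; $H_1,H_2$ need not be linear. For $t,s\in[0,1]$ put $$\gamma(t)=\frac{\beta}{\Gamma(3-\alpha)}+\eta-t,\qquad K(t,s)=\beta+\frac{(\eta-s)^{\alpha-1}}{\Gamma(\alpha)}\chi_{[0,\eta]}(s)-\frac{(t-s)^{\alpha-1}}{\Gamma(\alpha)}\chi_{[0,t]}(s),$$ where $\chi_A$ is the characteristic function of $A$ (the corresponding term is $0$ when $s\notin A$), and for $u\in C[0,1]$ $$T(u)(t)=H_1[u]\gamma(t)+H_2[u]+\int_0^1K(t,s)f(s,u(s))\,ds .$$ Mild solution: the couple $(\lambda,u)$ with $u\in C[0,1]$ solves the boundary value problem in the mild sense if, by definition, $u(t)=\lambda\,T(u)(t)$ for all $t\in[0,1]$. Thresholds: $\beta_K=\frac{(1-\eta)^{\alpha-1}}{\Gamma(\alpha)}$, $\beta_\gamma=(1-\eta)\Gamma(3-\alpha)$, and $t^*=\min\{t_K,t_\gamma\}$ with $t_K=\eta+(\beta\Gamma(\alpha))^{1/(\alpha-1)}$ and $t_\gamma=\eta+\frac{\beta}{\Gamma(3-\alpha)}$. Constants and cone (for the fixed $b\in[\eta,t^*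 )$): $$c_{3,K}=\min\left\{\frac{\beta\Gamma(\alpha)-(b-\eta)^{\alpha-1}}{\beta\Gamma(\alpha)+\eta^{\alpha-1}},\ \frac{\beta\Gamma(\alpha)-(b-\eta)^{\alpha-1}}{(1-\eta)^{\alpha-1}-\beta\Gamma(\alpha)}\right\},$$ $$\sigma_{3,\gamma}=\frac{\beta+(\eta-b)\Gamma(3-\alpha)}{\max\{\beta+\eta\,\Gamma(3-\alpha),\ (1-\eta)\Gamma(3-\alpha)-\beta\}},\qquad \sigma_3=\min\{\sigma_{3,\gamma},1,c_{3,K}\},$$ $$P_{\sigma_3}=\Bigl\{u\in C[0,1]:\ \min_{t\in[0,b]}u(t)\ge\sigma_3\|u\|_\infty\Bigr\}.$$ *)

theory Defs
  imports "HOL-Analysis.Analysis"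
begin

(* C[0,1] as a metric space with the supremum metric. Its points are the continuous functions
   on [0,1], represented as functions real => real that are extensional outside {0..1}. *)
abbreviation C01 :: "(real \<Rightarrow> real) metric" where
  "C01 \<equiv> cfunspace (top_of_set {0..1}) euclidean_metric"

definition sup_norm :: "(real \<Rightarrow> real) \<Rightarrow> real" where
  "sup_norm u = (SUP t\<in>{0..1}. \<bar>u t\<bar>)"

lemma mspace_C01: "mspace C01 = {u. continuous_on {0..1} u \<and> u \<in> extensional {0..1}}"
proof -
  have "bounded (u ` {0..1::real})" if "continuous_on {0..1} u" for u :: "real \<Rightarrow> real"
    using that compact_continuous_image compact_imp_bounded by blast
  moreover have "Metric_space.mbounded UNIV dist = (bounded :: real set \<Rightarrow> bool)"
    by auto
  ultimately show ?thesis
    by auto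
qed

lemma mdist_C01:
  assumes "u \<in> mspace C01" "v \<in> mspace C01"
  shows "mdist C01 u v = sup_norm (\<lambda>t. u t - v t)"
proof -
  have "u \<in> Metric_space.fspace UNIV dist {0..1}" "v \<in> Metric_space.fspace UNIV dist {0..1}"
    using assms by (auto simp: Metric_space.fspace_def[OF Met_TC.Metric_space_axioms])
  then show ?thesis
    by (simp add: mdist_cfunspace_eq_mdist_funspace
        Metric_space.fdist_def[OF Met_TC.Metric_space_axioms] sup_norm_def dist_real_def)
qed

definition boundary_Omega :: "real \<Rightarrow> (real \<Rightarrow> real) set" where
  "boundary_Omega \<rho> = {u \<in> mspace C01. sup_norm u = \<rho>}"

(* Not necessarily linear: continuous, mapping bounded sets to relatively compact sets. *)
definition compact_functional :: "((real \<Rightarrow> real) \<Rightarrow> real) \<Rightarrow> bool" where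
  "compact_functional H \<longleftrightarrow>
     continuous_map (mtopology_of C01) euclidean H \<and>
     (\<forall>B. Metric_space.mbounded (mspace C01) (mdist C01) B \<longrightarrow> compact (closure (H ` B)))"

definition gamma_fn :: "real \<Rightarrow> real \<Rightarrow> real \<Rightarrow> real \<Rightarrow> real" where
  "gamma_fn \<alpha> \<beta> \<eta> t = \<beta> / Gamma (3 - \<alpha>) + \<eta> - t"

(* powr of a negative base is a junk value; the indicators make such terms vanish. *)
definition K_fn :: "real \<Rightarrow> real \<Rightarrow> real \<Rightarrow> real \<Rightarrow> real \<Rightarrow> real" where
  "K_fn \<alpha> \<beta> \<eta> t s =
     \<beta> + (\<eta> - s) powr (\<alpha> - 1) / Gamma \<alpha> * indicat_real {0..\<eta>} s
       - (t - s) powr (\<alpha> - 1) / Gamma \<alpha> * indicat_real {0..t} s"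

definition T_op ::
  "real \<Rightarrow> real \<Rightarrow> real \<Rightarrow> (real \<Rightarrow> real \<Rightarrow> real) \<Rightarrow> ((real \<Rightarrow> real) \<Rightarrow> real) \<Rightarrow>
   ((real \<Rightarrow> real) \<Rightarrow> real) \<Rightarrow> (real \<Rightarrow> real) \<Rightarrow> real \<Rightarrow> real" where
  "T_op \<alpha> \<beta> \<eta> f H1 H2 u t =
     H1 u * gamma_fn \<alpha> \<beta> \<eta> t + H2 u + integral {0..1} (\<lambda>s. K_fn \<alpha> \<beta> \<eta> t s * f s (u s))"

(* Mild solutions (l, u) of the problem with Caputo derivatives
     D^\<alpha> u(t) + l f(t, u(t)) = 0 on (0,1),
     u'(0) + l H1[u] = 0,  \<beta> D^(\<alpha>-1) u(1) + u(\<eta>) = l H2[u]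
   are by definition the solutions of the integral equation u = l T(u). *)
definition mild_solution ::
  "real \<Rightarrow> real \<Rightarrow> real \<Rightarrow> (real \<Rightarrow> real \<Rightarrow> real) \<Rightarrow> ((real \<Rightarrow> real) \<Rightarrow> real) \<Rightarrow>
   ((real \<Rightarrow> real) \<Rightarrow> real) \<Rightarrow> real \<Rightarrow> (real \<Rightarrow> real) \<Rightarrow> bool" where
  "mild_solution \<alpha> \<beta> \<eta> f H1 H2 l u \<longleftrightarrow>
     u \<in> mspace C01 \<and> (\<forall>t\<in>{0..1}. u t = l * T_op \<alpha> \<beta> \<eta> f H1 H2 u t)"

definition beta_K :: "real \<Rightarrow> real \<Rightarrow> real" where
  "beta_K \<alpha> \<eta> = (1 - \<eta>) powr (\<alpha> - 1) / Gamma \<alpha>"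

definition beta_gamma :: "real \<Rightarrow> real \<Rightarrow> real" where
  "beta_gamma \<alpha> \<eta> = (1 - \<eta>) * Gamma (3 - \<alpha>)"

definition t_K :: "real \<Rightarrow> real \<Rightarrow> real \<Rightarrow> real" where
  "t_K \<alpha> \<beta> \<eta> = \<eta> + (\<beta> * Gamma \<alpha>) powr (1 / (\<alpha> - 1))"

definition t_gamma :: "real \<Rightarrow> real \<Rightarrow> real \<Rightarrow> real" where
  "t_gamma \<alpha> \<beta> \<eta> = \<eta> + \<beta> / Gamma (3 - \<alpha>)"

definition t_star :: "real \<Rightarrow> real \<Rightarrow> real \<Rightarrow> real" where
  "t_star \<alpha> \<beta> \<eta> = min (t_K \<alpha> \<beta> \<eta>) (t_gamma \<alpha> \<beta> \<eta>)"

definition c3_K :: "real \<Rightarrow> real \<Rightarrow> real \<Rightarrow> real \<Rightarrow> real" where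
  "c3_K \<alpha> \<beta> \<eta> b = min
     ((\<beta> * Gamma \<alpha> - (b - \<eta>) powr (\<alpha> - 1)) / (\<beta> * Gamma \<alpha> + \<eta> powr (\<alpha> - 1)))
     ((\<beta> * Gamma \<alpha> - (b - \<eta>) powr (\<alpha> - 1)) / ((1 - \<eta>) powr (\<alpha> - 1) - \<beta> * Gamma \<alpha>))"

definition sigma3_gamma :: "real \<Rightarrow> real \<Rightarrow> real \<Rightarrow> real \<Rightarrow> real" where
  "sigma3_gamma \<alpha> \<beta> \<eta> b = (\<beta> + (\<eta> - b) * Gamma (3 - \<alpha>)) /
     max (\<beta> + \<eta> * Gamma (3 - \<alpha>)) ((1 - \<eta>) * Gamma (3 - \<alpha>) - \<beta>)"

definition sigma3 :: "real \<Rightarrow> real \<Rightarrow> real \<Rightarrow> real \<Rightarrow> real" where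
  "sigma3 \<alpha> \<beta> \<eta> b = min (sigma3_gamma \<alpha> \<beta> \<eta> b) (min 1 (c3_K \<alpha> \<beta> \<eta> b))"

(* The infimum is attained, because u is continuous on {0..b} (for 0 <= b <= 1). *)
definition cone_P :: "real \<Rightarrow> real \<Rightarrow> (real \<Rightarrow> real) set" where
  "cone_P b \<sigma> = {u \<in> mspace C01. (INF t\<in>{0..b}. u t) \<ge> \<sigma> * sup_norm u}"

end

theory Submission
  imports Defs "HOL-Complex_Analysis.Great_Picard"
begin

text \<open>
  The theorem is an eigenvalue statement, \<open>u = \<lambda> T u\<close>, for a compact operator \<open>T\<close> on \<open>C[0,1]\<close> and
  the cone \<open>P\<close> of functions whose minimum over \<open>[0,b]\<close> is at least \<open>\<sigma>\<close> times their supremum norm. It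
  follows from a Birkhoff--Kellogg theorem in cones, \<open>birkhoff_kellogg_cone\<close>: if \<open>T\<close> maps
  \<open>P \<inter> \<partial>\<Omega>\<close> compactly into \<open>P\<close> and stays away from \<open>0\<close>, then \<open>T\<close> preserves some ray of \<open>P\<close>.

  The special form of \<open>P\<close> makes this easy. Since \<open>0 \<in> [0,b]\<close>, the linear functional \<open>u(0)\<close> lies
  between \<open>\<sigma>\<parallel>u\<parallel>\<close> and \<open>\<parallel>u\<parallel>\<close> on \<open>P\<close>, so the functions in \<open>P\<close> with \<open>u(0) = 1\<close> form a bounded closed
  convex set that meets every ray of the cone once. On it the rescaled operator
  \<open>u \<mapsto> T(\<rho>u/\<parallel>u\<parallel>) / T(\<rho>u/\<parallel>u\<parallel>)(0)\<close> is a compact self-map, and Schauder's theorem gives a fixed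
  point. Schauder's theorem is obtained from a fixed point theorem for the Hilbert cube, which in turn
  comes directly from Kuhn's labelling lemma (\<open>hilbert_cube_fixed_point\<close>, \<open>schauder\<close>).

  What has to be checked about the operator is the following. It maps all of \<open>C[0,1]\<close> into \<open>P\<close>,
  because \<open>\<sigma>\<close> is chosen such that \<open>\<sigma>|K(t',s)| \<le> K(t,s)\<close> and \<open>\<sigma>|\<gamma>(t')| \<le> \<gamma>(t)\<close> for \<open>t \<in> [0,b]\<close> and
  arbitrary \<open>t'\<close> (\<open>K_cone_estimate\<close>, \<open>gamma_cone_estimate\<close>, \<open>T_cone_estimate\<close>). It is compact, because
  the kernel is Hoelder continuous in \<open>t\<close> with exponent \<open>\<alpha> - 1\<close>, uniformly in \<open>s\<close> (\<open>T_b_continuous\<close>,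
  \<open>T_b_compact\<close>). And \<open>T u(0)\<close> is at least the left-hand side of the positivity hypothesis for
  \<open>u \<in> P \<inter> \<partial>\<Omega>\<close>, since such \<open>u\<close> take values in \<open>[\<sigma>\<rho>,\<rho>]\<close> on \<open>[0,b]\<close> (\<open>T_lower\<close>).
\<close>

section \<open>Fixed points: the Hilbert cube and the theorem of Schauder\<close>

lemma tendsto_coordinatewise:
  fixes X :: "'a \<Rightarrow> 'i \<Rightarrow> 'b :: topological_space"
  shows "(X \<longlongrightarrow> x) F \<longleftrightarrow> (\<forall>i. ((\<lambda>n. X n i) \<longlongrightarrow> x i) F)"
  using limitin_componentwise[of "\<lambda>_::'i. euclidean" UNIV X x F]
  unfolding euclidean_product_topology limitin_canonical_iff by simp

text \<open>
  The infinite-dimensional Brouwer theorem needs no more than Kuhn's combinatorial lemma. On the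
  grid of mesh $1/p$ in the first \<open>p\<close> coordinates, all other coordinates being \<open>0\<close>, a point gets in
  coordinate \<open>i\<close> the label \<open>0\<close> if \<open>F\<close> does not decrease that coordinate and \<open>1\<close> if \<open>F\<close> does not
  increase it. Kuhn's lemma gives a grid cell in which every coordinate \<open>i < p\<close> sees both labels.
  As \<open>p\<close> grows, a subsequence of these cells shrinks to a single point \<open>x\<close> of the compact cube, and
  by continuity \<open>x i \<le> F x i\<close> and \<open>F x i \<le> x i\<close> for every \<open>i\<close>. Dimension
  and mesh go to the limit together. Maps of a finite-dimensional cube are the case in which \<open>F\<close>
  ignores the remaining coordinates.
\<close>

theorem hilbert_cube_fixed_point:
  fixes F :: "(nat \<Rightarrow> real) \<Rightarrow> nat \<Rightarrow> real"
  defines "Q \<equiv> {x. \<forall>i. x i \<in> {0..1}}"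
  assumes cont: "continuous_on Q F" and maps: "F ` Q \<subseteq> Q"
  obtains x where "x \<in> Q" "F x = x"
proof -
  define pt :: "nat \<Rightarrow> (nat \<Rightarrow> nat) \<Rightarrow> nat \<Rightarrow> real"
    where "pt p v j = (if j < p \<and> v j \<le> p then real (v j) / real p else 0)" for p v j
  have pt_Q: "pt p v \<in> Q" for p v
    by (auto simp: pt_def Q_def divide_le_eq_1)
  have F_range: "0 \<le> F (pt p v) i" "F (pt p v) i \<le> 1" for p v i
    using maps pt_Q[of p v] by (auto simp: Q_def image_subset_iff)
  \<comment> \<open>Both boundary conditions of Kuhn's lemma are met because \<open>F\<close> maps into the cube: on the face \<open>0\<close> the value cannot decrease, on the face \<open>1\<close> it cannot increase.\<close>
  define label :: "nat \<Rightarrow> (nat \<Rightarrow> nat) \<Rightarrow> nat \<Rightarrow> nat"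
    where "label p v i = (if v i \<noteq> 0 \<and> F (pt p v) i \<le> pt p v i then 1 else 0)" for p v i
  have "\<exists>q. (\<forall>i<p. q i < p) \<and> (\<forall>i<p. \<exists>r s. (\<forall>j<p. q j \<le> r j \<and> r j \<le> q j + 1) \<and>
          (\<forall>j<p. q j \<le> s j \<and> s j \<le> q j + 1) \<and> label p r i \<noteq> label p s i)" if "p > 0" for p
  proof (rule kuhn_lemma[of p p "label p"])
    show "0 < p" by fact
    show "\<forall>x. (\<forall>i<p. x i \<le> p) \<longrightarrow> (\<forall>i<p. label p x i = 0 \<or> label p x i = 1)"
      by (simp add: label_def)
    show "\<forall>x. (\<forall>i<p. x i \<le> p) \<longrightarrow> (\<forall>i<p. x i = 0 \<longrightarrow> label p x i = 0)"
      by (simp add: label_def)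
    show "\<forall>x. (\<forall>i<p. x i \<le> p) \<longrightarrow> (\<forall>i<p. x i = p \<longrightarrow> label p x i = 1)"
      using F_range that by (auto simp: label_def pt_def)
  qed blast
  then have "\<forall>n. \<exists>q. (\<forall>i<Suc n. q i < Suc n) \<and> (\<forall>i<Suc n. \<exists>r s. (\<forall>j<Suc n. q j \<le> r j \<and> r j \<le> q j + 1) \<and>
          (\<forall>j<Suc n. q j \<le> s j \<and> s j \<le> q j + 1) \<and> label (Suc n) r i \<noteq> label (Suc n) s i)"
    by blast
  then obtain q where q_less: "\<And>n i. i < Suc n \<Longrightarrow> q n i < Suc n"
    and q_label: "\<And>n i. i < Suc n \<Longrightarrow> \<exists>r s. (\<forall>j<Suc n. q n j \<le> r j \<and> r j \<le> q n j + 1) \<and>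
          (\<forall>j<Suc n. q n j \<le> s j \<and> s j \<le> q n j + 1) \<and> label (Suc n) r i \<noteq> label (Suc n) s i"
    by metis
  have "compact Q"
  proof -
    have "compactin (product_topology (\<lambda>_::nat. euclidean) UNIV) (PiE UNIV (\<lambda>_. {0..1::real}))"
      by (simp add: compactin_PiE)
    moreover have "PiE UNIV (\<lambda>_. {0..1::real}) = Q"
      by (auto simp: Q_def PiE_iff)
    ultimately show ?thesis
      by (simp add: euclidean_product_topology)
  qed
  then have "seq_compact Q"
    by (rule compact_imp_seq_compact)
  from seq_compactE[OF this, of "\<lambda>n. pt (Suc n) (q n)"] pt_Q
  obtain x k where x: "x \<in> Q" and k: "strict_mono (k :: nat \<Rightarrow> nat)"
    and lim: "(\<lambda>n. pt (Suc (k n)) (q (k n))) \<longlonglongrightarrow> x"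
    by (auto simp: o_def)
  have lim_i: "(\<lambda>n. pt (Suc (k n)) (q (k n)) i) \<longlonglongrightarrow> x i" for i
    using lim by (simp add: tendsto_coordinatewise)
  have k_ge: "n \<le> k n" for n
    using k by (rule seq_suble)
  \<comment> \<open>All vertices of the selected cells, not just the base vertices \<open>q\<close>, have the same limit.\<close>
  have neighbour_lim: "(\<lambda>n. pt (Suc (k n)) (v n)) \<longlonglongrightarrow> x"
    if v: "\<And>n j. n \<ge> n0 \<Longrightarrow> j \<le> k n \<Longrightarrow> q (k n) j \<le> v n j \<and> v n j \<le> q (k n) j + 1" for v n0
    unfolding tendsto_coordinatewise
  proof
    fix j
    have "\<forall>\<^sub>F n in sequentially.
        norm (pt (Suc (k n)) (v n) j - pt (Suc (k n)) (q (k n)) j) \<le> 1 / real (Suc n)"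
      using eventually_ge_at_top[of "max n0 j"]
    proof eventually_elim
      case (elim n)
      then have j: "j \<le> k n" "j < Suc (k n)"
        using k_ge[of n] by auto
      then have vn: "q (k n) j \<le> v n j" "v n j \<le> q (k n) j + 1" "q (k n) j < Suc (k n)"
        using v[of n j] q_less[of j "k n"] elim by auto
      then have "norm (pt (Suc (k n)) (v n) j - pt (Suc (k n)) (q (k n)) j)
          = (real (v n j) - real (q (k n) j)) / real (Suc (k n))"
        using j by (simp add: pt_def diff_divide_distrib[symmetric] del: of_nat_Suc)
      also have "\<dots> \<le> 1 / real (Suc n)"
        using vn k_ge[of n] by (intro frac_le) auto
      finally show ?case .
    qed
    then have "(\<lambda>n. pt (Suc (k n)) (v n) j - pt (Suc (k n)) (q (k n)) j) \<longlonglongrightarrow> 0"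
      by (rule Lim_null_comparison) (rule LIMSEQ_Suc[OF lim_1_over_n])
    from tendsto_add[OF this lim_i[of j]] show "(\<lambda>n. pt (Suc (k n)) (v n) j) \<longlonglongrightarrow> x j"
      by simp
  qed
  have F_lim: "(\<lambda>n. F (X n) i) \<longlonglongrightarrow> F x i" if "X \<longlonglongrightarrow> x" "\<And>n. X n \<in> Q" for X i
    using continuous_on_tendsto_compose[OF cont that(1) x] that(2)
    by (auto simp: tendsto_coordinatewise)
  have "F x i = x i" for i
  proof -
    have "\<exists>r s. (\<forall>j\<le>k n. q (k n) j \<le> r j \<and> r j \<le> q (k n) j + 1) \<and>
          (\<forall>j\<le>k n. q (k n) j \<le> s j \<and> s j \<le> q (k n) j + 1) \<and>
          label (Suc (k n)) r i = 0 \<and> label (Suc (k n)) s i = 1" if "n \<ge> i" for n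
    proof -
      have "i < Suc (k n)"
        using k_ge[of n] that by simp
      from q_label[OF this] obtain r s where
        rs: "\<forall>j\<le>k n. q (k n) j \<le> r j \<and> r j \<le> q (k n) j + 1"
          "\<forall>j\<le>k n. q (k n) j \<le> s j \<and> s j \<le> q (k n) j + 1"
        and ne: "label (Suc (k n)) r i \<noteq> label (Suc (k n)) s i"
        by (auto simp: less_Suc_eq_le)
      have "label (Suc (k n)) r i = 0 \<and> label (Suc (k n)) s i = 1 \<or>
            label (Suc (k n)) s i = 0 \<and> label (Suc (k n)) r i = 1"
        using ne by (auto simp: label_def split: if_splits)
      then show ?thesis using rs by blast
    qed
    then have "\<exists>r s. \<forall>n\<ge>i. (\<forall>j\<le>k n. q (k n) j \<le> r n j \<and> r n j \<le> q (k n) j + 1) \<and>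
          (\<forall>j\<le>k n. q (k n) j \<le> s n j \<and> s n j \<le> q (k n) j + 1) \<and>
          label (Suc (k n)) (r n) i = 0 \<and> label (Suc (k n)) (s n) i = 1"
      by metis
    then obtain r s where
      r: "\<And>n j. n \<ge> i \<Longrightarrow> j \<le> k n \<Longrightarrow> q (k n) j \<le> r n j \<and> r n j \<le> q (k n) j + 1"
      and s: "\<And>n j. n \<ge> i \<Longrightarrow> j \<le> k n \<Longrightarrow> q (k n) j \<le> s n j \<and> s n j \<le> q (k n) j + 1"
      and r0: "\<And>n. n \<ge> i \<Longrightarrow> label (Suc (k n)) (r n) i = 0"
      and s1: "\<And>n. n \<ge> i \<Longrightarrow> label (Suc (k n)) (s n) i = 1"
      by blast
    have r_lim: "(\<lambda>n. pt (Suc (k n)) (r n)) \<longlonglongrightarrow> x" and s_lim: "(\<lambda>n. pt (Suc (k n)) (s n)) \<longlonglongrightarrow> x"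
      using neighbour_lim[of i r] neighbour_lim[of i s] r s by blast+
    \<comment> \<open>The label \<open>0\<close> vertices give one inequality in the limit, the label \<open>1\<close> vertices the other.\<close>
    have "x i \<le> F x i"
    proof (rule tendsto_le[OF _ F_lim[OF r_lim pt_Q] r_lim[unfolded tendsto_coordinatewise, rule_format]])
      show "\<forall>\<^sub>F n in sequentially. pt (Suc (k n)) (r n) i \<le> F (pt (Suc (k n)) (r n)) i"
        using eventually_ge_at_top[of i]
      proof eventually_elim
        case (elim n)
        show ?case
          using r0[OF elim] F_range[of "Suc (k n)" "r n" i]
          by (cases "r n i = 0") (auto simp: label_def pt_def split: if_splits)
      qed
    qed simp
    moreover have "F x i \<le> x i"
    proof (rule tendsto_le[OF _ s_lim[unfolded tendsto_coordinatewise, rule_format] F_lim[OF s_lim pt_Q]])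
      show "\<forall>\<^sub>F n in sequentially. F (pt (Suc (k n)) (s n)) i \<le> pt (Suc (k n)) (s n) i"
        using eventually_ge_at_top[of i]
      proof eventually_elim
        case (elim n)
        show ?case
          using s1[OF elim] by (auto simp: label_def split: if_splits)
      qed
    qed simp
    ultimately show "F x i = x i" by simp
  qed
  then show thesis
    using that x by blast
qed

text \<open>
  The Schauder projection reduces the problem to finitely many coordinates. Let \<open>y 0, ..., y (m-1)\<close>
  be an \<open>\<epsilon>\<close>-net of \<open>K\<close> and let \<open>w i z / W z\<close> be the partition of unity subordinate to the balls
  around the net points, so that \<open>z\<close> is within \<open>\<epsilon>\<close> of the convex combination of the \<open>y i\<close> with these
  weights. The cube is used in place of the simplex of weights, so an arbitrary cube point \<open>a\<close> has to
  be turned into a point \<open>g a\<close> of \<open>X\<close>: a total weight below \<open>1\<close> is filled up at \<open>y 0\<close>, a total weight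
  above \<open>1\<close> is normalised. The map sending \<open>a\<close> to the weights of \<open>f (g a)\<close> has a fixed point; its
  total weight is exactly \<open>1\<close>, hence \<open>g a\<close> is the projection of \<open>f (g a)\<close>.
\<close>

lemma schauder_approx:
  fixes f :: "'a::real_normed_vector \<Rightarrow> 'a"
  assumes "convex X" "X \<noteq> {}" and cont: "continuous_on X f"
    and "compact K" "K \<subseteq> X" "f ` X \<subseteq> K" and "\<epsilon> > 0"
  obtains x where "x \<in> X" "dist (f x) x \<le> \<epsilon>"
proof -
  obtain N where N: "finite N" "N \<subseteq> K" "K \<subseteq> (\<Union>y\<in>N. ball y \<epsilon>)"
    using seq_compact_imp_totally_bounded[OF compact_imp_seq_compact[OF \<open>compact K\<close>]] \<open>\<epsilon> > 0\<close> by auto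
  then obtain m y where y: "N = y ` {i::nat. i < m}"
    using finite_imp_nat_seg_image_inj_on by metis
  have net: "\<exists>i<m. dist (y i) z < \<epsilon>" if "z \<in> K" for z
    using N(3) that by (force simp: y)
  have "m > 0"
    using net assms(2,6) by fastforce
  have yX: "y i \<in> X" if "i < m" for i
    using N(2) y that \<open>K \<subseteq> X\<close> by blast
  define w where "w i z = max 0 (\<epsilon> - dist (y i) z)" for i z
  define W where "W z = (\<Sum>i<m. w i z)" for z
  have w_nonneg: "w i z \<ge> 0" for i z
    by (simp add: w_def)
  have W_pos: "W z > 0" if "z \<in> K" for z
  proof -
    obtain i where "i < m" "dist (y i) z < \<epsilon>"
      using net[OF \<open>z \<in> K\<close>] by blast
    then show ?thesis
      unfolding W_def by (intro sum_pos2[of _ i]) (auto simp: w_def)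
  qed
  define Q :: "(nat \<Rightarrow> real) set" where "Q = {a. \<forall>i. a i \<in> {0..1}}"
  define g where "g a = ((\<Sum>i<m. a i *\<^sub>R y i) + max 0 (1 - (\<Sum>i<m. a i)) *\<^sub>R y 0) /\<^sub>R max 1 (\<Sum>i<m. a i)"
    for a :: "nat \<Rightarrow> real"
  have gX: "g a \<in> X" if "a \<in> Q" for a
  proof -
    \<comment> \<open>The coefficients that exhibit \<open>g a\<close> as a convex combination of the net.\<close>
    define c where "c i = (a i + (if i = 0 then max 0 (1 - (\<Sum>i<m. a i)) else 0)) / max 1 (\<Sum>i<m. a i)" for i
    have "(\<Sum>i<m. (if i = 0 then max 0 (1 - (\<Sum>i<m. a i)) else 0)) = max 0 (1 - (\<Sum>i<m. a i))"
      using \<open>m > 0\<close> by (simp add: sum.delta)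
    then have "(\<Sum>i<m. c i) = 1"
      unfolding c_def by (simp add: sum_divide_distrib[symmetric] sum.distrib del: sum.delta) (simp add: max_def)
    moreover have "c i \<ge> 0" for i
      using that by (auto simp: c_def Q_def)
    ultimately have "(\<Sum>i<m. c i *\<^sub>R y i) \<in> X"
      using \<open>convex X\<close> yX by (intro convex_sum) auto
    moreover have "(\<Sum>i<m. c i *\<^sub>R y i) = g a"
    proof -
      have "(\<Sum>i<m. (if i = 0 then max 0 (1 - (\<Sum>i<m. a i)) else 0) *\<^sub>R y i)
          = (\<Sum>i<m. if i = 0 then max 0 (1 - (\<Sum>i<m. a i)) *\<^sub>R y i else 0)"
        by (intro sum.cong) auto
      also have "\<dots> = max 0 (1 - (\<Sum>i<m. a i)) *\<^sub>R y 0"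
        using \<open>m > 0\<close> by (simp add: sum.delta)
      finally show ?thesis
        unfolding c_def g_def scaleR_sum_right
        by (simp add: divide_inverse_commute scaleR_add_left sum.distrib scaleR_sum_right[symmetric]
            scaleR_scaleR[symmetric] del: scaleR_scaleR)
    qed
    ultimately show ?thesis by simp
  qed
  define F where "F a i = (if i < m then w i (f (g a)) / W (f (g a)) else 0)" for a i
  have fg: "f (g a) \<in> K" if "a \<in> Q" for a
    using gX[OF that] assms(6) by blast
  have coord_cont: "continuous_on Q (\<lambda>a. a i)" for i
    by (rule continuous_on_product_then_coordinatewise[OF continuous_on_id])
  have g_cont: "continuous_on Q g"
    unfolding g_def by (intro continuous_intros coord_cont) auto
  have fg_cont: "continuous_on Q (\<lambda>a. f (g a))"
    using continuous_on_compose2[OF cont g_cont] gX by blast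
  have "continuous_on Q (\<lambda>a. F a i)" for i
  proof (cases "i < m")
    case True
    then show ?thesis
      unfolding F_def W_def w_def using W_pos[OF fg]
      by (auto intro!: continuous_intros fg_cont simp: W_def w_def) (metis less_irrefl)
  qed (simp add: F_def)
  then have F_cont: "continuous_on Q F"
    by (rule continuous_on_coordinatewise_then_product)
  have "F ` Q \<subseteq> Q"
  proof (clarsimp simp: image_subset_iff)
    fix a assume a: "a \<in> Q"
    have "F a i \<in> {0..1}" for i
    proof -
      have "w i (f (g a)) \<le> W (f (g a))" if "i < m"
        unfolding W_def using that by (intro member_le_sum) (auto simp: w_nonneg)
      then show ?thesis
        using W_pos[OF fg[OF a]] w_nonneg[of i] by (auto simp: F_def)
    qed
    then show "F a \<in> Q" by (simp add: Q_def)
  qed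
  then obtain a where a: "a \<in> Q" "F a = a"
    using hilbert_cube_fixed_point[of F] F_cont unfolding Q_def by metis
  define z where "z = f (g a)"
  have ai: "a i = w i z / W z" if "i < m" for i
    using fun_cong[OF a(2), of i] that by (simp add: F_def z_def)
  have "W z > 0"
    using W_pos fg a(1) z_def by simp
  then have sum_a: "(\<Sum>i<m. a i) = 1"
    by (simp add: ai sum_divide_distrib[symmetric]) (simp add: W_def)
  have "z - g a = (\<Sum>i<m. a i *\<^sub>R (z - y i))"
    by (simp add: g_def sum_a scaleR_diff_right sum_subtractf scaleR_sum_left[symmetric])
  also have "norm \<dots> \<le> (\<Sum>i<m. a i * \<epsilon>)"
  proof (rule sum_norm_le)
    fix i assume i: "i \<in> {..<m}"
    show "norm (a i *\<^sub>R (z - y i)) \<le> a i * \<epsilon>"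
    proof (cases "dist (y i) z < \<epsilon>")
      case True
      then show ?thesis
        using a(1) by (auto simp: Q_def dist_norm norm_minus_commute intro!: mult_left_mono)
    next
      case False
      then have "a i = 0"
        using i by (simp add: ai w_def)
      then show ?thesis by simp
    qed
  qed
  also have "\<dots> = \<epsilon>"
    using sum_a by (simp add: sum_distrib_right[symmetric])
  finally have "dist (f (g a)) (g a) \<le> \<epsilon>"
    by (simp add: z_def dist_norm)
  then show thesis
    using that gX a(1) by blast
qed

text \<open>
  Schauder's theorem: approximate fixed points \<open>x n\<close> exist, their images accumulate at a point of
  the compact set \<open>K\<close>, and so do the \<open>x n\<close> themselves.
\<close>

theorem schauder:
  fixes f :: "'a::real_normed_vector \<Rightarrow> 'a"
  assumes "convex X" "X \<noteq> {}" and cont: "continuous_on X f"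
    and "compact K" "K \<subseteq> X" "f ` X \<subseteq> K"
  obtains x where "x \<in> X" "f x = x"
proof -
  have "\<exists>x\<in>X. dist (f x) x \<le> 1 / real (Suc n)" for n
    using schauder_approx[OF assms, of "1 / real (Suc n)"] by (metis of_nat_0_less_iff zero_less_Suc zero_less_divide_1_iff)
  then obtain x where x: "\<And>n. x n \<in> X" "\<And>n. dist (f (x n)) (x n) \<le> 1 / real (Suc n)"
    by metis
  have fx: "\<forall>n. f (x n) \<in> K"
    using x(1) assms(6) by blast
  from seq_compactE[OF compact_imp_seq_compact[OF \<open>compact K\<close>], of "\<lambda>n. f (x n)"] fx
  obtain l k where l: "l \<in> K" and k: "strict_mono (k :: nat \<Rightarrow> nat)"
    and lim: "(\<lambda>n. f (x (k n))) \<longlonglongrightarrow> l"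
    by (auto simp: o_def)
  have "(\<lambda>n. dist (x (k n)) (f (x (k n)))) \<longlonglongrightarrow> 0"
  proof (rule tendsto_sandwich[OF _ _ tendsto_const])
    show "(\<lambda>n. 1 / real (Suc (k n))) \<longlonglongrightarrow> 0"
      using LIMSEQ_subseq_LIMSEQ[OF LIMSEQ_Suc[OF lim_1_over_n] k] by (simp add: o_def)
  qed (use x(2) in \<open>auto simp: dist_commute\<close>)
  then have "(\<lambda>n. x (k n)) \<longlonglongrightarrow> l"
    using Lim_transform[OF lim] by (simp add: dist_norm tendsto_norm_zero_iff norm_minus_commute)
  then have "(\<lambda>n. f (x (k n))) \<longlonglongrightarrow> f l"
    by (rule continuous_on_tendsto_compose[OF cont]) (use l \<open>K \<subseteq> X\<close> x(1) in auto)
  then have "f l = l"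
    using lim LIMSEQ_unique by blast
  then show thesis
    using that l \<open>K \<subseteq> X\<close> by blast
qed

section \<open>A Birkhoff--Kellogg theorem in cones\<close>

text \<open>
  The part \<open>P \<inter> sphere 0 \<rho>\<close> of the sphere is not convex, so Schauder's theorem does not apply to
  it. But a linear functional \<open>\<phi>\<close> that dominates the norm on \<open>P\<close> provides the convex base
  \<open>B = {x \<in> P. \<phi> x = 1}\<close>, and every ray of the cone meets \<open>B\<close> and the sphere exactly once. Going
  radially from \<open>B\<close> to the sphere, applying \<open>T\<close>, and going radially back to \<open>B\<close> is a continuous map
  with relatively compact range, because \<open>\<phi>\<close> is at least \<open>d > 0\<close> on the images under \<open>T\<close>. A fixed
  point of it is a ray that \<open>T\<close> maps into itself.
\<close>

theorem birkhoff_kellogg_cone: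
  fixes P :: "'a::real_normed_vector set" and \<phi> :: "'a \<Rightarrow> real" and T :: "'a \<Rightarrow> 'a"
  assumes "closed P" "convex P" "cone P"
    and "bounded_linear \<phi>" and "\<kappa> > 0" and \<phi>_norm: "\<And>x. x \<in> P \<Longrightarrow> \<kappa> * norm x \<le> \<phi> x"
    and "p \<in> P" "p \<noteq> 0" and "\<rho> > 0"
    and cont: "continuous_on (P \<inter> sphere 0 \<rho>) T"
    and "compact K" and T_P: "T ` (P \<inter> sphere 0 \<rho>) \<subseteq> P \<inter> K"
    and "d > 0" and T_ge: "\<And>x. x \<in> P \<inter> sphere 0 \<rho> \<Longrightarrow> d \<le> \<phi> (T x)"
  obtains l u where "l > 0" "u \<in> P \<inter> sphere 0 \<rho>" "u = l *\<^sub>R T u"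
proof -
  interpret \<phi>: bounded_linear \<phi> by fact
  define B where "B = P \<inter> {x. \<phi> x = 1}"
  define N where "N x = (\<rho> / norm x) *\<^sub>R x" for x :: 'a
  define S where "S x = T (N x) /\<^sub>R \<phi> (T (N x))" for x
  define C where "C = (\<lambda>y. y /\<^sub>R \<phi> y) ` (K \<inter> P \<inter> {y. d \<le> \<phi> y})"
  have scale: "c *\<^sub>R x \<in> P" if "x \<in> P" "c \<ge> 0" for c x
    using \<open>cone P\<close> that by (auto simp: cone_def)
  have B_nz: "x \<noteq> 0" if "x \<in> B" for x
    using that by (auto simp: B_def \<phi>.zero)
  have N_sphere: "N x \<in> P \<inter> sphere 0 \<rho>" if "x \<in> B" for x
    using B_nz[OF that] that \<open>\<rho> > 0\<close> by (auto simp: N_def B_def intro!: scale)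
  have "convex B"
  proof -
    have "convex (\<phi> -` {1})"
      by (intro convex_linear_vimage \<phi>.linear convex_singleton)
    then show ?thesis
      unfolding B_def vimage_def using \<open>convex P\<close> by (intro convex_Int) auto
  qed
  moreover have "B \<noteq> {}"
  proof -
    have "\<phi> p > 0"
      using \<phi>_norm[OF \<open>p \<in> P\<close>] \<open>p \<noteq> 0\<close> \<open>\<kappa> > 0\<close> by (smt (verit) mult_pos_pos zero_less_norm_iff)
    then have "p /\<^sub>R \<phi> p \<in> B"
      using \<open>p \<in> P\<close> by (auto simp: B_def \<phi>.scaleR intro!: scale)
    then show ?thesis by blast
  qed
  moreover have "continuous_on B S"
  proof -
    have "continuous_on B N"
      unfolding N_def using B_nz by (auto intro!: continuous_intros)
    then have TN: "continuous_on B (\<lambda>x. T (N x))"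
      using continuous_on_compose2[OF cont] N_sphere by blast
    moreover have "continuous_on B (\<lambda>x. \<phi> (T (N x)))"
      using \<phi>.continuous_on[OF TN] .
    moreover have "\<phi> (T (N x)) \<noteq> 0" if "x \<in> B" for x
      using T_ge[OF N_sphere[OF that]] \<open>d > 0\<close> by simp
    ultimately show ?thesis
      unfolding S_def by (auto intro!: continuous_intros)
  qed
  moreover have "compact C"
    unfolding C_def
  proof (rule compact_continuous_image)
    have cont_\<phi>: "continuous_on A \<phi>" for A
      by (rule \<phi>.continuous_on[OF continuous_on_id])
    show "compact (K \<inter> P \<inter> {y. d \<le> \<phi> y})"
      using \<open>compact K\<close> \<open>closed P\<close> cont_\<phi>
      by (intro compact_Int_closed closed_Collect_le) auto
    show "continuous_on (K \<inter> P \<inter> {y. d \<le> \<phi> y}) (\<lambda>y. y /\<^sub>R \<phi> y)"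
      using \<open>d > 0\<close> by (intro continuous_intros cont_\<phi>) auto
  qed
  moreover have "C \<subseteq> B"
    using \<open>d > 0\<close> by (auto simp: C_def B_def \<phi>.scaleR intro!: scale)
  moreover have "S ` B \<subseteq> C"
    unfolding C_def S_def using T_P T_ge N_sphere by (auto 0 4 simp: image_subset_iff)
  ultimately obtain x where x: "x \<in> B" "S x = x"
    using schauder[of B S C] by blast
  define u where "u = N x"
  have u: "u \<in> P \<inter> sphere 0 \<rho>"
    using N_sphere x(1) u_def by simp
  have pos: "\<phi> (T u) > 0"
    using T_ge[OF u] \<open>d > 0\<close> by simp
  have "u = (\<rho> / norm x) *\<^sub>R S x"
    by (simp add: x(2) u_def N_def)
  also have "\<dots> = (\<rho> / (norm x * \<phi> (T u))) *\<^sub>R T u"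
    by (simp add: S_def u_def divide_simps)
  finally show thesis
    using that u pos B_nz[OF x(1)] \<open>\<rho> > 0\<close> by (metis divide_pos_pos mult_pos_pos zero_less_norm_iff)
qed

section \<open>Truncated powers\<close>

text \<open>
  Subadditivity of concave powers: the fractions \<open>x / (x + y)\<close> and \<open>y / (x + y)\<close> add up to \<open>1\<close>
  and can only grow when raised to an exponent of at most \<open>1\<close>.
\<close>

lemma powr_add_le:
  fixes x y \<theta> :: real
  assumes "0 \<le> x" "0 \<le> y" "0 < \<theta>" "\<theta> \<le> 1"
  shows "(x + y) powr \<theta> \<le> x powr \<theta> + y powr \<theta>"
proof (cases "x + y = 0")
  case False
  then have pos: "x + y > 0"
    using assms by simp
  have part: "z / (x + y) \<le> z powr \<theta> / (x + y) powr \<theta>" if "0 \<le> z" "z \<le> x + y" for z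
  proof (cases "z = 0")
    case False
    then have "(z / (x + y)) powr 1 \<le> (z / (x + y)) powr \<theta>"
      using that pos assms by (intro powr_mono') auto
    then show ?thesis
      using that pos by (simp add: powr_divide)
  qed simp
  have "1 = x / (x + y) + y / (x + y)"
    using pos by (simp add: add_divide_distrib[symmetric])
  also have "\<dots> \<le> x powr \<theta> / (x + y) powr \<theta> + y powr \<theta> / (x + y) powr \<theta>"
    using assms by (intro add_mono part) auto
  also have "\<dots> = (x powr \<theta> + y powr \<theta>) / (x + y) powr \<theta>"
    by (simp add: add_divide_distrib)
  finally show ?thesis
    using pos by (simp add: le_divide_eq)
qed (use assms in auto)

text \<open>
  The truncated power, the factor \<open>(t - s)\<^sup>\<theta>\<close> of a fractional integral kernel extended by \<open>0\<close>
  to \<open>s > t\<close>. Written with the maximum it replaces the indicator functions of the kernel and is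
  visibly continuous.
\<close>

definition tpow :: "real \<Rightarrow> real \<Rightarrow> real" where
  "tpow \<theta> x = max 0 x powr \<theta>"

lemma tpow_nonneg [simp]: "0 \<le> tpow \<theta> x"
  by (simp add: tpow_def)

lemma tpow_eq: "0 \<le> x \<Longrightarrow> tpow \<theta> x = x powr \<theta>"
  by (simp add: tpow_def)

lemma tpow_mono: "0 \<le> \<theta> \<Longrightarrow> x \<le> y \<Longrightarrow> tpow \<theta> x \<le> tpow \<theta> y"
  by (auto simp: tpow_def intro!: powr_mono2)

lemma tpow_add_le:
  assumes "0 < \<theta>" "\<theta> \<le> 1"
  shows "tpow \<theta> (x + y) \<le> tpow \<theta> x + tpow \<theta> y"
proof -
  have "tpow \<theta> (x + y) \<le> (max 0 x + max 0 y) powr \<theta>"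
    using assms by (auto simp: tpow_def intro!: powr_mono2)
  then show ?thesis
    using powr_add_le[of "max 0 x" "max 0 y" \<theta>] assms by (simp add: tpow_def)
qed

lemma tpow_hoelder:
  assumes "0 < \<theta>" "\<theta> \<le> 1"
  shows "\<bar>tpow \<theta> x - tpow \<theta> y\<bar> \<le> \<bar>x - y\<bar> powr \<theta>"
proof -
  have "tpow \<theta> x - tpow \<theta> y \<le> \<bar>x - y\<bar> powr \<theta>" for x y
  proof -
    have "tpow \<theta> x \<le> tpow \<theta> (y + \<bar>x - y\<bar>)"
      using assms by (intro tpow_mono) auto
    also have "\<dots> \<le> tpow \<theta> y + \<bar>x - y\<bar> powr \<theta>"
      using tpow_add_le[OF assms, of y "\<bar>x - y\<bar>"] by (simp add: tpow_eq)
    finally show ?thesis by simp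
  qed
  from this[of x y] this[of y x] show ?thesis
    by (simp add: abs_minus_commute)
qed

lemma tpow_cont:
  assumes "0 < \<theta>" "continuous_on A g"
  shows "continuous_on A (\<lambda>x. tpow \<theta> (g x))"
  unfolding tpow_def
  by (rule continuous_on_powr') (use assms in \<open>auto intro: continuous_on_max continuous_on_const\<close>)

section \<open>The kernel and its cone estimates\<close>

locale bvp_kernel =
  fixes \<alpha> \<beta> \<eta> b :: real
  assumes \<alpha>: "1 < \<alpha>" "\<alpha> \<le> 2" and \<eta>: "0 < \<eta>" "\<eta> < 1" and \<beta>: "0 < \<beta>"
    and \<beta>_less: "\<beta> < min (beta_K \<alpha> \<eta>) (beta_gamma \<alpha> \<eta>)"
    and b: "\<eta> \<le> b" "b < t_star \<alpha> \<beta> \<eta>"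
begin

abbreviation "\<sigma> \<equiv> sigma3 \<alpha> \<beta> \<eta> b"
abbreviation "K \<equiv> K_fn \<alpha> \<beta> \<eta>"
abbreviation "\<gamma> \<equiv> gamma_fn \<alpha> \<beta> \<eta>"

lemma Gamma_pos: "0 < Gamma \<alpha>" "0 < Gamma (3 - \<alpha>)"
  using \<alpha> by (auto intro!: Gamma_real_pos)

lemma exponent: "0 < \<alpha> - 1" "\<alpha> - 1 \<le> 1"
  using \<alpha> by auto

lemma b_less_1: "b < 1"
proof -
  have "\<beta> / Gamma (3 - \<alpha>) < 1 - \<eta>"
    using \<beta>_less Gamma_pos by (simp add: beta_gamma_def divide_less_eq)
  then show ?thesis
    using b(2) by (simp add: t_star_def t_gamma_def)
qed

lemma power_b_less: "(b - \<eta>) powr (\<alpha> - 1) < \<beta> * Gamma \<alpha>"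
proof -
  have "b - \<eta> < (\<beta> * Gamma \<alpha>) powr (1 / (\<alpha> - 1))"
    using b(2) by (simp add: t_star_def t_K_def)
  then have "(b - \<eta>) powr (\<alpha> - 1) < ((\<beta> * Gamma \<alpha>) powr (1 / (\<alpha> - 1))) powr (\<alpha> - 1)"
    using b(1) exponent by (intro powr_less_mono2) auto
  also have "\<dots> = \<beta> * Gamma \<alpha>"
    using exponent \<beta> Gamma_pos by (simp add: powr_powr)
  finally show ?thesis .
qed

lemma K_eq:
  assumes "0 \<le> s"
  shows "K t s = \<beta> + tpow (\<alpha> - 1) (\<eta> - s) / Gamma \<alpha> - tpow (\<alpha> - 1) (t - s) / Gamma \<alpha>"
  using assms by (auto simp: K_fn_def tpow_def indicator_def max_def)

lemma K_times_Gamma: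
  assumes "0 \<le> s"
  shows "K t s * Gamma \<alpha> = \<beta> * Gamma \<alpha> + tpow (\<alpha> - 1) (\<eta> - s) - tpow (\<alpha> - 1) (t - s)"
  using assms Gamma_pos by (simp add: K_eq left_diff_distrib distrib_right)

text \<open>
  Subadditivity of the truncated power at \<open>t - s \<le> (\<eta> - s) + (c - \<eta>)\<close> bounds the kernel
  below independently of \<open>s\<close>. It is used twice: with \<open>c = b\<close>, where the bound is positive because
  \<open>b\<close> is below \<open>t_K\<close>, and with \<open>c = 1\<close>, where it limits how negative the kernel can get.
\<close>

lemma K_lower:
  assumes "\<eta> \<le> c" "t \<le> c" "0 \<le> s"
  shows "\<beta> * Gamma \<alpha> - (c - \<eta>) powr (\<alpha> - 1) \<le> K t s * Gamma \<alpha>"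
proof -
  have "tpow (\<alpha> - 1) (t - s) \<le> tpow (\<alpha> - 1) ((\<eta> - s) + (c - \<eta>))"
    using assms exponent by (intro tpow_mono) auto
  also have "\<dots> \<le> tpow (\<alpha> - 1) (\<eta> - s) + (c - \<eta>) powr (\<alpha> - 1)"
    using tpow_add_le[OF exponent, of "\<eta> - s" "c - \<eta>"] assms by (simp add: tpow_eq)
  finally show ?thesis
    using assms by (simp add: K_times_Gamma)
qed

lemma K_upper:
  assumes "0 \<le> s"
  shows "K t s * Gamma \<alpha> \<le> \<beta> * Gamma \<alpha> + \<eta> powr (\<alpha> - 1)"
proof -
  have "tpow (\<alpha> - 1) (\<eta> - s) \<le> \<eta> powr (\<alpha> - 1)"
    using tpow_mono[of "\<alpha> - 1" "\<eta> - s" \<eta>] assms exponent \<eta> by (simp add: tpow_eq)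
  then show ?thesis
    unfolding K_times_Gamma[OF assms] using tpow_nonneg[of "\<alpha> - 1" "t - s"] by linarith
qed

text \<open>
  The lower bound \<open>m\<close> of the kernel for \<open>t \<le> b\<close> is compared with its upper bound \<open>M1\<close> if the other
  value is positive and with the bound \<open>- M2\<close> from below if it is negative, all three multiplied by
  \<open>Gamma \<alpha>\<close>. The quotients of \<open>m\<close> by \<open>M1\<close> and \<open>M2\<close> are those in \<^const>\<open>c3_K\<close>.
\<close>

lemma K_cone_estimate:
  assumes "t \<in> {0..b}" "t' \<in> {0..1}" "s \<in> {0..1}"
  shows "\<sigma> * \<bar>K t' s\<bar> \<le> K t s"
proof -
  define m where "m = \<beta> * Gamma \<alpha> - (b - \<eta>) powr (\<alpha> - 1)"
  define M1 where "M1 = \<beta> * Gamma \<alpha> + \<eta> powr (\<alpha> - 1)"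
  define M2 where "M2 = (1 - \<eta>) powr (\<alpha> - 1) - \<beta> * Gamma \<alpha>"
  have m: "m > 0" and M1: "M1 > 0"
    using power_b_less \<beta> Gamma_pos by (auto simp: m_def M1_def intro!: add_pos_nonneg)
  have M2: "M2 > 0"
    using \<beta>_less Gamma_pos by (simp add: M2_def beta_K_def less_divide_eq)
  have "c3_K \<alpha> \<beta> \<eta> b = min (m / M1) (m / M2)"
    by (simp add: c3_K_def m_def M1_def M2_def)
  then have c: "\<sigma> \<le> m / M1" "\<sigma> \<le> m / M2"
    unfolding sigma3_def by linarith+
  have "\<sigma> * (\<bar>K t' s\<bar> * Gamma \<alpha>) \<le> m"
  proof (cases "K t' s \<ge> 0")
    case True
    have "\<sigma> * (\<bar>K t' s\<bar> * Gamma \<alpha>) \<le> m / M1 * (\<bar>K t' s\<bar> * Gamma \<alpha>)"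
      using c Gamma_pos by (intro mult_right_mono) auto
    also have "\<dots> \<le> m / M1 * M1"
      using True K_upper[of s t'] assms m M1 by (intro mult_left_mono) (auto simp: M1_def)
    finally show ?thesis using M1 by simp
  next
    case False
    have "\<sigma> * (\<bar>K t' s\<bar> * Gamma \<alpha>) \<le> m / M2 * (\<bar>K t' s\<bar> * Gamma \<alpha>)"
      using c Gamma_pos by (intro mult_right_mono) auto
    also have "\<dots> \<le> m / M2 * M2"
      using False K_lower[of 1 t' s] assms m M2 \<eta> by (intro mult_left_mono) (auto simp: M2_def)
    finally show ?thesis using M2 by simp
  qed
  also have "m \<le> K t s * Gamma \<alpha>"
    using K_lower[of b t s] assms b by (simp add: m_def)
  finally have "(\<sigma> * \<bar>K t' s\<bar>) * Gamma \<alpha> \<le> K t s * Gamma \<alpha>"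
    by (simp add: mult.assoc)
  then show ?thesis
    using Gamma_pos by simp
qed

lemma gamma_b_pos: "0 < \<beta> + (\<eta> - b) * Gamma (3 - \<alpha>)"
proof -
  have "b - \<eta> < \<beta> / Gamma (3 - \<alpha>)"
    using b(2) by (simp add: t_star_def t_gamma_def)
  then show ?thesis
    using Gamma_pos by (simp add: less_divide_eq algebra_simps)
qed

lemma gamma_max_pos: "0 < max (\<beta> + \<eta> * Gamma (3 - \<alpha>)) ((1 - \<eta>) * Gamma (3 - \<alpha>) - \<beta>)"
  using \<beta> \<eta> Gamma_pos by (simp add: less_max_iff_disj add_pos_pos)

lemma sigma3_pos: "0 < \<sigma>"
proof -
  have "0 < \<beta> * Gamma \<alpha> + \<eta> powr (\<alpha> - 1)"
    using \<beta> Gamma_pos by (simp add: add_pos_nonneg)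
  moreover have "0 < (1 - \<eta>) powr (\<alpha> - 1) - \<beta> * Gamma \<alpha>"
    using \<beta>_less Gamma_pos by (simp add: beta_K_def less_divide_eq)
  ultimately show ?thesis
    using power_b_less gamma_b_pos gamma_max_pos
    by (simp add: sigma3_def sigma3_gamma_def c3_K_def del: less_max_iff_disj)
qed

lemma sigma3_le_1: "\<sigma> \<le> 1"
  by (simp add: sigma3_def)

text \<open>
  \<open>\<gamma>\<close> is decreasing, so its minimum on \<open>{0..b}\<close> is \<open>\<gamma> b\<close> and its modulus on \<open>{0..1}\<close> is at most
  the larger one of \<open>\<gamma> 0\<close> and \<open>- \<gamma> 1\<close>; multiplied by \<open>Gamma (3 - \<alpha>)\<close> these are the numerator and
  the two terms in the denominator of \<^const>\<open>sigma3_gamma\<close>.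
\<close>

lemma gamma_cone_estimate:
  assumes "t \<in> {0..b}" "t' \<in> {0..1}"
  shows "\<sigma> * \<bar>\<gamma> t'\<bar> \<le> \<gamma> t"
proof -
  define M where "M = max (\<beta> + \<eta> * Gamma (3 - \<alpha>)) ((1 - \<eta>) * Gamma (3 - \<alpha>) - \<beta>)"
  have M: "M > 0" and M_eq: "\<sigma> \<le> (\<beta> + (\<eta> - b) * Gamma (3 - \<alpha>)) / M"
    using gamma_max_pos by (auto simp: M_def sigma3_def sigma3_gamma_def)
  have \<gamma>_eq: "\<gamma> r * Gamma (3 - \<alpha>) = \<beta> + (\<eta> - r) * Gamma (3 - \<alpha>)" for r
    using Gamma_pos by (simp add: gamma_fn_def field_simps)
  have mono: "\<gamma> r * Gamma (3 - \<alpha>) \<le> \<gamma> q * Gamma (3 - \<alpha>)" if "q \<le> r" for q r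
    using that Gamma_pos by (simp add: gamma_fn_def)
  have "\<bar>\<gamma> t' * Gamma (3 - \<alpha>)\<bar> \<le> M"
    using mono[of 0 t'] mono[of t' 1] assms \<gamma>_eq[of 0] \<gamma>_eq[of 1]
    by (auto simp: M_def abs_le_iff algebra_simps le_max_iff_disj)
  then have "\<sigma> * \<bar>\<gamma> t' * Gamma (3 - \<alpha>)\<bar> \<le> (\<beta> + (\<eta> - b) * Gamma (3 - \<alpha>)) / M * M"
    using M_eq M sigma3_pos by (intro mult_mono) auto
  also have "\<dots> = \<gamma> b * Gamma (3 - \<alpha>)"
    using M \<gamma>_eq[of b] by simp
  also have "\<dots> \<le> \<gamma> t * Gamma (3 - \<alpha>)"
    using mono assms by simp
  finally have "(\<sigma> * \<bar>\<gamma> t'\<bar>) * Gamma (3 - \<alpha>) \<le> \<gamma> t * Gamma (3 - \<alpha>)"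
    using Gamma_pos by (simp add: abs_mult mult.assoc)
  then show ?thesis
    using Gamma_pos by simp
qed

lemma K_nonneg: "t \<in> {0..b} \<Longrightarrow> s \<in> {0..1} \<Longrightarrow> 0 \<le> K t s"
  using K_cone_estimate[of t 0 s] sigma3_pos by (smt (verit) atLeastAtMost_iff zero_le_mult_iff)

lemma gamma_nonneg: "t \<in> {0..b} \<Longrightarrow> 0 \<le> \<gamma> t"
  using gamma_cone_estimate[of t 0] sigma3_pos by (smt (verit) atLeastAtMost_iff zero_le_mult_iff)

text \<open>
  The cone estimate itself bounds the kernel: all its values are controlled by those at \<open>t = 0\<close>.
\<close>

lemma K_bounded: "\<exists>M. \<forall>t\<in>{0..1}. \<forall>s\<in>{0..1}. \<bar>K t s\<bar> \<le> M"
proof -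
  have "\<sigma> * \<bar>K t s\<bar> \<le> \<beta> + \<eta> powr (\<alpha> - 1) / Gamma \<alpha>" if "t \<in> {0..1}" "s \<in> {0..1}" for t s
  proof -
    have "\<sigma> * \<bar>K t s\<bar> \<le> K 0 s"
      using that b \<eta> by (intro K_cone_estimate) auto
    also have "\<dots> \<le> \<beta> + \<eta> powr (\<alpha> - 1) / Gamma \<alpha>"
      using K_upper[of s 0] that Gamma_pos by (simp add: field_simps)
    finally show ?thesis .
  qed
  then have "\<forall>t\<in>{0..1}. \<forall>s\<in>{0..1}. \<bar>K t s\<bar> \<le> (\<beta> + \<eta> powr (\<alpha> - 1) / Gamma \<alpha>) / \<sigma>"
    using sigma3_pos by (simp add: pos_le_divide_eq mult.commute)
  then show ?thesis by blast
qed

lemma K_cont: "continuous_on {0..1} (K t)"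
proof (subst continuous_on_cong[OF refl K_eq])
  show "continuous_on {0..1} (\<lambda>s. \<beta> + tpow (\<alpha> - 1) (\<eta> - s) / Gamma \<alpha> - tpow (\<alpha> - 1) (t - s) / Gamma \<alpha>)"
    using exponent Gamma_pos(1)[THEN less_imp_neq] by (intro continuous_intros tpow_cont) simp_all
qed auto

lemma K_hoelder:
  assumes "0 \<le> s"
  shows "\<bar>K t s - K t' s\<bar> \<le> \<bar>t - t'\<bar> powr (\<alpha> - 1) / Gamma \<alpha>"
proof -
  have "\<bar>K t s - K t' s\<bar> = \<bar>tpow (\<alpha> - 1) (t' - s) - tpow (\<alpha> - 1) (t - s)\<bar> / Gamma \<alpha>"
  proof -
    have "K t s - K t' s = (tpow (\<alpha> - 1) (t' - s) - tpow (\<alpha> - 1) (t - s)) / Gamma \<alpha>"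
      using assms by (simp add: K_eq diff_divide_distrib)
    then show ?thesis
      using Gamma_pos by (simp add: abs_divide)
  qed
  also have "\<dots> \<le> \<bar>t - t'\<bar> powr (\<alpha> - 1) / Gamma \<alpha>"
    using tpow_hoelder[OF exponent, of "t' - s" "t - s"] Gamma_pos
    by (intro divide_right_mono) (auto simp: abs_minus_commute)
  finally show ?thesis .
qed

end

section \<open>The space C[0,1] as a normed vector space\<close>

lemma clamp_01 [simp]: "0 \<le> clamp 0 1 (t::real)" "clamp 0 1 (t::real) \<le> 1"
  using clamp_in_interval[of "0::real" 1 t] by simp_all

lemma clamp_01_id [simp]: "t \<in> {0..1::real} \<Longrightarrow> clamp 0 1 t = t"
  using clamp_cancel_cbox[of t 0 1] by simp

text \<open>
  The fixed point theorems above live in normed vector spaces that are types. A copy of \<open>C[0,1]\<close>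
  of this kind is the closed subspace of those bounded continuous functions on the real line that are
  constant to the left of \<open>0\<close> and to the right of \<open>1\<close>.
\<close>

definition clamped :: "(real \<Rightarrow>\<^sub>C real) set" where
  "clamped = {v. \<forall>t. apply_bcontfun v t = apply_bcontfun v (clamp 0 1 t)}"

definition to_bcontfun :: "(real \<Rightarrow> real) \<Rightarrow> (real \<Rightarrow>\<^sub>C real)" where
  "to_bcontfun u = Bcontfun (\<lambda>t. u (clamp 0 1 t))"

definition to_C01 :: "(real \<Rightarrow>\<^sub>C real) \<Rightarrow> real \<Rightarrow> real" where
  "to_C01 v = restrict (apply_bcontfun v) {0..1}"

lemma apply_to_bcontfun:
  assumes "continuous_on {0..1} u"
  shows "apply_bcontfun (to_bcontfun u) t = u (clamp 0 1 t)"
proof -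
  have "bounded (u ` cbox 0 1)"
    using assms by (simp add: compact_continuous_image compact_imp_bounded)
  then have "(\<lambda>t. u (clamp 0 1 t)) \<in> bcontfun"
    using assms by (auto simp: bcontfun_def intro!: clamp_continuous_on clamp_bounded)
  then show ?thesis
    by (simp add: to_bcontfun_def Bcontfun_inverse)
qed

lemma to_bcontfun_clamped: "continuous_on {0..1} u \<Longrightarrow> to_bcontfun u \<in> clamped"
  by (simp add: clamped_def apply_to_bcontfun)

lemma clamped_norm_le:
  assumes "v \<in> clamped" "\<And>t. t \<in> {0..1} \<Longrightarrow> \<bar>apply_bcontfun v t\<bar> \<le> B"
  shows "norm v \<le> B"
proof (rule norm_bound)
  fix t
  have "apply_bcontfun v t = apply_bcontfun v (clamp 0 1 t)"
    using assms(1) by (simp add: clamped_def)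
  then show "norm (apply_bcontfun v t) \<le> B"
    using assms(2)[of "clamp 0 1 t"] by simp
qed

lemma clamped_diff: "v \<in> clamped \<Longrightarrow> w \<in> clamped \<Longrightarrow> v - w \<in> clamped"
  by (simp add: clamped_def)

lemma tendsto_apply_bcontfun:
  "(v \<longlongrightarrow> l) F \<Longrightarrow> ((\<lambda>n. apply_bcontfun (v n) t) \<longlongrightarrow> apply_bcontfun l t) F"
  using tendsto_uniform_limitI[OF tendsto_bcontfun_uniform_limit] by blast

lemma continuous_on_apply_at: "continuous_on A (\<lambda>v. apply_bcontfun v t)"
  unfolding continuous_on_def by (auto intro: tendsto_apply_bcontfun tendsto_ident_at)

lemma closed_clamped: "closed clamped"
  unfolding clamped_def
  by (intro closed_Collect_all closed_Collect_eq continuous_on_apply_at)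

lemma to_C01_mem: "to_C01 v \<in> mspace C01"
proof -
  have "continuous_on {0..1} (to_C01 v)"
    by (rule continuous_on_eq[of _ "apply_bcontfun v"]) (auto simp: to_C01_def)
  then show ?thesis
    unfolding mspace_C01 by (simp only: mem_Collect_eq) (simp add: to_C01_def)
qed

lemma sup_norm_le:
  "(\<And>t. t \<in> {0..1} \<Longrightarrow> \<bar>u t\<bar> \<le> B) \<Longrightarrow> sup_norm u \<le> B"
  unfolding sup_norm_def by (rule cSUP_least) auto

lemma sup_norm_to_C01:
  assumes "v \<in> clamped"
  shows "sup_norm (to_C01 v) = norm v"
proof (rule antisym)
  show "sup_norm (to_C01 v) \<le> norm v"
    using norm_bounded[of v] by (intro sup_norm_le) (auto simp: to_C01_def)
  have "bdd_above ((\<lambda>t. \<bar>to_C01 v t\<bar>) ` {0..1})"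
    using norm_bounded[of v] by (intro bdd_aboveI[of _ "norm v"]) (auto simp: to_C01_def)
  then have "\<bar>apply_bcontfun v t\<bar> \<le> sup_norm (to_C01 v)" if "t \<in> {0..1}" for t
    using cSUP_upper[OF that, of "\<lambda>t. \<bar>to_C01 v t\<bar>"] that by (simp add: sup_norm_def to_C01_def)
  then show "norm v \<le> sup_norm (to_C01 v)"
    by (rule clamped_norm_le[OF assms])
qed

lemma mdist_to_C01_le: "mdist C01 (to_C01 v) (to_C01 w) \<le> dist v w"
  unfolding mdist_C01[OF to_C01_mem to_C01_mem]
  using dist_bounded[of v _ w]
  by (intro sup_norm_le) (auto simp: to_C01_def dist_real_def)

lemma compact_functional_continuous:
  assumes "compact_functional H"
  shows "continuous_on A (\<lambda>v. H (to_C01 v))"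
proof -
  have "Lipschitz_continuous_map euclidean_metric C01 to_C01"
    unfolding Lipschitz_continuous_map_def
    using to_C01_mem mdist_to_C01_le by (auto intro!: exI[of _ 1])
  then have "continuous_map euclidean (mtopology_of C01) to_C01"
    using Lipschitz_continuous_imp_continuous_map by fastforce
  then have "continuous_map euclidean euclidean (H \<circ> to_C01)"
    using assms continuous_map_compose unfolding compact_functional_def by blast
  then show ?thesis
    by (auto simp: o_def intro: continuous_on_subset)
qed

lemma compact_functional_bounded:
  assumes "compact_functional H"
  obtains B where "\<And>v. norm v \<le> \<rho> \<Longrightarrow> \<bar>H (to_C01 v)\<bar> \<le> B"
proof -
  interpret Metric_space "mspace C01" "mdist C01" by (rule Metric_space_mspace_mdist)
  have "to_C01 ` cball 0 \<rho> \<subseteq> mcball (to_C01 0) \<rho>"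
  proof safe
    fix v :: "real \<Rightarrow>\<^sub>C real" assume "v \<in> cball 0 \<rho>"
    then show "to_C01 v \<in> mcball (to_C01 0) \<rho>"
      unfolding in_mcball using to_C01_mem order_trans[OF mdist_to_C01_le[of 0 v]]
      by (metis mem_cball)
  qed
  then have "mbounded (to_C01 ` cball 0 \<rho>)"
    unfolding mbounded_def by blast
  then have "bounded (H ` to_C01 ` cball 0 \<rho>)"
    using assms compact_imp_bounded bounded_subset[OF _ closure_subset]
    unfolding compact_functional_def by blast
  then obtain B where "\<forall>v\<in>cball 0 \<rho>. \<bar>H (to_C01 v)\<bar> \<le> B"
    unfolding bounded_iff by auto
  then show thesis
    using that[of B] by simp
qed

text \<open>
  The Arzela--Ascoli theorem in the form needed for a map with smoothing values: a common bound and
  a common modulus of continuity are closed conditions, and they cut out a compact set.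
\<close>

lemma compact_equicontinuous_clamped:
  assumes \<omega>: "(\<omega> \<longlongrightarrow> 0) (at_right (0::real))"
  shows "compact {v \<in> clamped. norm v \<le> R \<and>
           (\<forall>s\<in>{0..1}. \<forall>t\<in>{0..1}. \<bar>apply_bcontfun v s - apply_bcontfun v t\<bar> \<le> \<omega> \<bar>s - t\<bar>)}" (is "compact ?K")
  unfolding compact_def
proof (intro allI impI)
  fix F :: "nat \<Rightarrow> real \<Rightarrow>\<^sub>C real" assume F: "\<forall>n. F n \<in> ?K"
  then have equi: "\<bar>apply_bcontfun (F n) s - apply_bcontfun (F n) t\<bar> \<le> \<omega> \<bar>s - t\<bar>"
    if "s \<in> {0..1}" "t \<in> {0..1}" for n s t
    using that by blast
  obtain g k where g: "continuous_on {0..1} g" and k: "strict_mono (k :: nat \<Rightarrow> nat)"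
    and lim: "\<And>e. 0 < e \<Longrightarrow> \<exists>N. \<forall>n x. n \<ge> N \<and> x \<in> {0..1} \<longrightarrow> norm (apply_bcontfun (F (k n)) x - g x) < e"
  proof (rule Arzela_Ascoli[of "{0..1}" "\<lambda>n. apply_bcontfun (F n)" R])
    show "norm (apply_bcontfun (F n) x) \<le> R" for n x
      using F norm_bounded[of "F n" x] order_trans by blast
    fix x e :: real assume x: "x \<in> {0..1}" and e: "0 < e"
    obtain d where d: "d > 0" "\<And>h. 0 < h \<Longrightarrow> h < d \<Longrightarrow> \<omega> h < e"
      using order_tendstoD(2)[OF \<omega> e] unfolding eventually_at_right_field by auto
    have "norm (apply_bcontfun (F n) x - apply_bcontfun (F n) y) < e"
      if "y \<in> {0..1}" "norm (x - y) < d" for n y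
    proof (cases "x = y")
      case False
      then show ?thesis
        using equi[OF x that(1), of n] that(2) d(2)[of "\<bar>x - y\<bar>"] by simp
    qed (use e in simp)
    then show "\<exists>d. 0 < d \<and> (\<forall>n y. y \<in> {0..1} \<and> norm (x - y) < d \<longrightarrow>
        norm (apply_bcontfun (F n) x - apply_bcontfun (F n) y) < e)"
      using d(1) by (intro exI[of _ d]) simp
  qed auto
  define l where "l = to_bcontfun g"
  have lim': "(\<lambda>n. F (k n)) \<longlonglongrightarrow> l"
  proof (rule LIMSEQ_I)
    fix e :: real assume "0 < e"
    then obtain N where N: "\<And>n x. n \<ge> N \<Longrightarrow> x \<in> {0..1} \<Longrightarrow> norm (apply_bcontfun (F (k n)) x - g x) < e / 2"
      using lim[OF half_gt_zero] by blast
    have "norm (F (k n) - l) \<le> e / 2" if "n \<ge> N" for n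
    proof (rule clamped_norm_le)
      show "F (k n) - l \<in> clamped"
        using F g by (auto simp: l_def intro!: clamped_diff to_bcontfun_clamped)
      show "\<bar>apply_bcontfun (F (k n) - l) t\<bar> \<le> e / 2" if "t \<in> {0..1}" for t
        using N[OF \<open>n \<ge> N\<close> that] that g by (simp add: l_def apply_to_bcontfun)
    qed
    then show "\<exists>N. \<forall>n\<ge>N. norm (F (k n) - l) < e"
      using \<open>0 < e\<close> by (force intro: le_less_trans)
  qed
  moreover have "closed ?K"
  proof -
    have "closed (\<Inter>s\<in>{0..1}. \<Inter>t\<in>{0..1}. {v. \<bar>apply_bcontfun v s - apply_bcontfun v t\<bar> \<le> \<omega> \<bar>s - t\<bar>})"
      by (intro closed_INT ballI closed_Collect_le continuous_intros continuous_on_apply_at)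
    moreover have "closed {v :: real \<Rightarrow>\<^sub>C real. norm v \<le> R}"
      by (intro closed_Collect_le continuous_intros)
    ultimately have "closed (clamped \<inter> {v. norm v \<le> R} \<inter>
        (\<Inter>s\<in>{0..1}. \<Inter>t\<in>{0..1}. {v. \<bar>apply_bcontfun v s - apply_bcontfun v t\<bar> \<le> \<omega> \<bar>s - t\<bar>}))"
      using closed_clamped by (intro closed_Int)
    moreover have "\<dots> = ?K" by blast
    ultimately show ?thesis by simp
  qed
  then have "l \<in> ?K"
    using closed_sequentially[OF _ _ lim'] F by blast
  ultimately show "\<exists>l\<in>?K. \<exists>r. strict_mono r \<and> (F \<circ> r) \<longlonglongrightarrow> l"
    using k by (auto simp: o_def)
qed

section \<open>The integral operator\<close>

locale bvp = bvp_kernel +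
  fixes f :: "real \<Rightarrow> real \<Rightarrow> real" and H1 H2 :: "(real \<Rightarrow> real) \<Rightarrow> real"
  assumes f_cont: "continuous_on ({0..1} \<times> UNIV) (\<lambda>(t, x). f t x)"
    and f_nonneg: "\<And>t x. t \<in> {0..1} \<Longrightarrow> 0 \<le> f t x"
    and H1: "compact_functional H1" "\<And>u. u \<in> mspace C01 \<Longrightarrow> 0 \<le> H1 u"
    and H2: "compact_functional H2" "\<And>u. u \<in> mspace C01 \<Longrightarrow> 0 \<le> H2 u"
begin

abbreviation "T \<equiv> T_op \<alpha> \<beta> \<eta> f H1 H2"

lemma f_u_cont:
  assumes "continuous_on {0..1} u"
  shows "continuous_on {0..1} (\<lambda>s. f s (u s))"
proof -
  have "continuous_on {0..1} (\<lambda>s. (s, u s))"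
    by (intro continuous_intros assms)
  from continuous_on_compose2[OF f_cont this] show ?thesis
    by auto
qed

lemma K_f_integrable:
  assumes "continuous_on {0..1} u"
  shows "(\<lambda>s. K t s * f s (u s)) integrable_on {0..1}"
  by (intro integrable_continuous_interval continuous_on_mult K_cont f_u_cont assms)

lemma f_bounded:
  obtains F where "\<And>s x. s \<in> {0..1} \<Longrightarrow> \<bar>x\<bar> \<le> \<rho> \<Longrightarrow> f s x \<le> F"
proof -
  have "compact ((\<lambda>(t, x). f t x) ` ({0..1} \<times> {-\<rho>..\<rho>}))"
    by (intro compact_continuous_image continuous_on_subset[OF f_cont] compact_Times) auto
  then have "bounded ((\<lambda>(t, x). f t x) ` ({0..1} \<times> {-\<rho>..\<rho>}))"
    by (rule compact_imp_bounded)
  then obtain F where F: "\<forall>t\<in>{0..1}. \<forall>x\<in>{-\<rho>..\<rho>}. \<bar>f t x\<bar> \<le> F"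
    unfolding bounded_iff by auto
  have "f s x \<le> F" if "s \<in> {0..1}" "\<bar>x\<bar> \<le> \<rho>" for s x
    using F[rule_format, of s x] that by (auto simp: abs_le_iff)
  then show thesis
    by (rule that)
qed

text \<open>
  Each of the three summands of \<open>T u\<close> satisfies the estimate, the integral because \<open>f\<close> is
  nonnegative. It holds for every \<open>u\<close>, so the whole space is
  mapped into the cone.
\<close>

lemma T_cone_estimate:
  assumes u: "u \<in> mspace C01" and t: "t \<in> {0..b}" "t' \<in> {0..1}"
  shows "\<sigma> * \<bar>T u t'\<bar> \<le> T u t"
proof -
  have cont: "continuous_on {0..1} u"
    using u by (simp only: mspace_C01 mem_Collect_eq)
  have "\<bar>integral {0..1} (\<lambda>s. \<sigma> * (K t' s * f s (u s)))\<bar> \<le> integral {0..1} (\<lambda>s. K t s * f s (u s))"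
    unfolding real_norm_def[symmetric]
  proof (rule integral_norm_bound_integral)
    fix s :: real assume s: "s \<in> {0..1}"
    have "(\<sigma> * \<bar>K t' s\<bar>) * f s (u s) \<le> K t s * f s (u s)"
      by (intro mult_right_mono K_cone_estimate t s f_nonneg)
    then show "norm (\<sigma> * (K t' s * f s (u s))) \<le> K t s * f s (u s)"
      using sigma3_pos f_nonneg[OF s] by (simp add: abs_mult)
  qed (intro integrable_on_mult_right K_f_integrable cont)+
  then have int: "\<sigma> * \<bar>integral {0..1} (\<lambda>s. K t' s * f s (u s))\<bar> \<le> integral {0..1} (\<lambda>s. K t s * f s (u s))"
    using sigma3_pos by (simp add: abs_mult)
  have "H1 u * (\<sigma> * \<bar>\<gamma> t'\<bar>) \<le> H1 u * \<gamma> t"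
    by (intro mult_left_mono gamma_cone_estimate t H1 u)
  moreover have "\<sigma> * H2 u \<le> H2 u"
    using mult_right_mono[OF sigma3_le_1 H2(2)[OF u]] by simp
  moreover have "\<bar>T u t'\<bar> \<le> H1 u * \<bar>\<gamma> t'\<bar> + H2 u + \<bar>integral {0..1} (\<lambda>s. K t' s * f s (u s))\<bar>"
    using H1(2)[OF u] H2(2)[OF u] unfolding T_op_def
    by (intro order_trans[OF abs_triangle_ineq] add_mono) (auto simp: abs_mult)
  then have "\<sigma> * \<bar>T u t'\<bar> \<le> \<sigma> * (H1 u * \<bar>\<gamma> t'\<bar> + H2 u + \<bar>integral {0..1} (\<lambda>s. K t' s * f s (u s))\<bar>)"
    using sigma3_pos by (intro mult_left_mono) auto
  ultimately show ?thesis
    using int unfolding T_op_def by (simp add: algebra_simps)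
qed

text \<open>
  The modulus of continuity of \<open>T u\<close> depends on \<open>u\<close> only through \<open>H1 u\<close> and a bound of
  \<open>f\<close> along \<open>u\<close>. This is what makes \<open>T\<close> map balls to equicontinuous sets.
\<close>

lemma T_modulus:
  assumes u: "u \<in> mspace C01" and F: "\<And>s. s \<in> {0..1} \<Longrightarrow> f s (u s) \<le> F"
  shows "\<bar>T u t - T u t'\<bar> \<le> H1 u * \<bar>t - t'\<bar> + F * tpow (\<alpha> - 1) \<bar>t - t'\<bar> / Gamma \<alpha>"
proof -
  have cont: "continuous_on {0..1} u"
    using u by (simp only: mspace_C01 mem_Collect_eq)
  define I where "I t = integral {0..1} (\<lambda>s. K t s * f s (u s))" for t
  have I_diff: "I t - I t' = integral {0..1} (\<lambda>s. K t s * f s (u s) - K t' s * f s (u s))"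
    unfolding I_def by (intro integral_diff[symmetric] K_f_integrable cont)
  have "norm (integral {0..1} (\<lambda>s. K t s * f s (u s) - K t' s * f s (u s)))
      \<le> integral {0..1} (\<lambda>s::real. tpow (\<alpha> - 1) \<bar>t - t'\<bar> / Gamma \<alpha> * F)"
  proof (rule integral_norm_bound_integral)
    fix s :: real assume s: "s \<in> {0..1}"
    have "\<bar>K t s - K t' s\<bar> * \<bar>f s (u s)\<bar> \<le> tpow (\<alpha> - 1) \<bar>t - t'\<bar> / Gamma \<alpha> * F"
      using s K_hoelder[of s t t'] F[OF s] f_nonneg[OF s] Gamma_pos
      by (intro mult_mono) (auto simp: tpow_eq)
    then show "norm (K t s * f s (u s) - K t' s * f s (u s)) \<le> tpow (\<alpha> - 1) \<bar>t - t'\<bar> / Gamma \<alpha> * F"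
      by (simp add: left_diff_distrib[symmetric] abs_mult)
  qed (intro integrable_diff K_f_integrable cont integrable_continuous_interval continuous_on_const)+
  then have I_le: "\<bar>I t - I t'\<bar> \<le> F * tpow (\<alpha> - 1) \<bar>t - t'\<bar> / Gamma \<alpha>"
    unfolding I_diff[symmetric] by (simp add: mult.commute)
  have "T u t - T u t' = H1 u * (\<gamma> t - \<gamma> t') + (I t - I t')"
    by (simp add: T_op_def I_def right_diff_distrib)
  also have "\<gamma> t - \<gamma> t' = t' - t"
    by (simp add: gamma_fn_def)
  finally have "\<bar>T u t - T u t'\<bar> \<le> \<bar>H1 u * (t' - t)\<bar> + \<bar>I t - I t'\<bar>"
    using abs_triangle_ineq by metis
  moreover have "\<bar>H1 u * (t' - t)\<bar> = H1 u * \<bar>t - t'\<bar>"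
    using H1(2)[OF u] by (simp add: abs_mult abs_minus_commute)
  ultimately show ?thesis
    using I_le by linarith
qed

lemma modulus_tendsto_0:
  "((\<lambda>h. A * h + F * tpow (\<alpha> - 1) h / Gamma \<alpha>) \<longlongrightarrow> 0) (at 0 within S)"
proof -
  have "continuous_on UNIV (\<lambda>h. A * h + F * tpow (\<alpha> - 1) h / Gamma \<alpha>)"
    using exponent Gamma_pos(1)[THEN less_imp_neq] by (intro continuous_intros tpow_cont) simp_all
  then have "((\<lambda>h. A * h + F * tpow (\<alpha> - 1) h / Gamma \<alpha>) \<longlongrightarrow> A * 0 + F * tpow (\<alpha> - 1) 0 / Gamma \<alpha>) (at 0 within UNIV)"
    unfolding continuous_on_def by blast
  then show ?thesis
    by (auto simp: tpow_def intro: tendsto_within_subset)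
qed

lemma T_continuous:
  assumes u: "u \<in> mspace C01"
  shows "continuous_on {0..1} (T u)"
proof -
  have "compact ((\<lambda>s. f s (u s)) ` {0..1})"
    using u by (intro compact_continuous_image f_u_cont) (simp_all only: mspace_C01 mem_Collect_eq compact_Icc)
  then have "bounded ((\<lambda>s. f s (u s)) ` {0..1})"
    by (rule compact_imp_bounded)
  then obtain F where "\<forall>s\<in>{0..1}. \<bar>f s (u s)\<bar> \<le> F"
    unfolding bounded_iff by auto
  then have F: "f s (u s) \<le> F" if "s \<in> {0..1}" for s
    using that by (meson abs_le_D1)
  define \<omega> where "\<omega> h = H1 u * h + F * tpow (\<alpha> - 1) h / Gamma \<alpha>" for h
  have "(T u \<longlongrightarrow> T u t) (at t within {0..1})" for t
  proof -
    have "\<forall>\<^sub>F s in at t within {0..1}. norm (T u s - T u t) \<le> \<omega> \<bar>s - t\<bar>"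
      using T_modulus[OF u F] by (auto simp: \<omega>_def)
    moreover have "((\<lambda>s. \<omega> \<bar>s - t\<bar>) \<longlongrightarrow> 0) (at t within {0..1})"
    proof -
      have zero: "\<omega> 0 = 0"
        by (simp add: \<omega>_def tpow_def)
      have "isCont \<omega> 0"
        unfolding isCont_def zero unfolding \<omega>_def by (rule modulus_tendsto_0)
      moreover have "((\<lambda>s. \<bar>s - t\<bar>) \<longlongrightarrow> \<bar>t - t\<bar>) (at t within {0..1})"
        by (intro tendsto_intros)
      ultimately have "((\<lambda>s. \<omega> \<bar>s - t\<bar>) \<longlongrightarrow> \<omega> 0) (at t within {0..1})"
        by (intro isCont_tendsto_compose[of 0 \<omega>]) simp_all
      then show ?thesis
        unfolding zero .
    qed
    ultimately have "((\<lambda>s. T u s - T u t) \<longlongrightarrow> 0) (at t within {0..1})"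
      by (rule Lim_null_comparison)
    then show ?thesis
      by (simp add: LIM_zero_iff)
  qed
  then show ?thesis
    by (simp add: continuous_on_def)
qed

text \<open>
  For \<open>t \<in> {0..b}\<close> the kernel is nonnegative in \<open>s\<close>, so \<open>f\<close> may be replaced by its lower bound on \<open>{0..b}\<close> and dropped
  on the rest of the interval.
\<close>

lemma T_lower:
  assumes u: "u \<in> mspace C01" and t: "t \<in> {0..b}"
    and \<delta>: "continuous_on {0..b} \<delta>" "\<And>s. s \<in> {0..b} \<Longrightarrow> \<delta> s \<le> f s (u s)"
    and \<eta>1: "\<eta>1 \<le> H1 u" and \<eta>2: "\<eta>2 \<le> H2 u"
  shows "\<gamma> t * \<eta>1 + \<eta>2 + integral {0..b} (\<lambda>s. K t s * \<delta> s) \<le> T u t"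
proof -
  have cont: "continuous_on {0..1} u"
    using u by (simp only: mspace_C01 mem_Collect_eq)
  have sub: "{0..b} \<subseteq> {0..1}"
    using b_less_1 by auto
  have int_b: "(\<lambda>s. K t s * f s (u s)) integrable_on {0..b}"
    using integrable_on_subinterval[OF K_f_integrable[OF cont]] sub by simp
  have "integral {0..b} (\<lambda>s. K t s * \<delta> s) \<le> integral {0..b} (\<lambda>s. K t s * f s (u s))"
  proof (rule integral_le[OF _ int_b])
    show "(\<lambda>s. K t s * \<delta> s) integrable_on {0..b}"
      by (intro integrable_continuous_interval continuous_on_mult \<delta> continuous_on_subset[OF K_cont sub])
    show "K t s * \<delta> s \<le> K t s * f s (u s)" if "s \<in> {0..b}" for s
      using that sub t by (intro mult_left_mono \<delta> K_nonneg) auto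
  qed
  also have "\<dots> \<le> integral {0..1} (\<lambda>s. K t s * f s (u s))"
    using K_nonneg[OF t] f_nonneg
    by (intro integral_subset_le sub int_b K_f_integrable cont) (auto intro!: mult_nonneg_nonneg)
  finally show ?thesis
    using mult_left_mono[OF \<eta>1 gamma_nonneg[OF t]] \<eta>2 unfolding T_op_def by (simp add: mult.commute)
qed

text \<open>
  The operator and the cone, transported to clamped functions.
\<close>

definition T_b :: "(real \<Rightarrow>\<^sub>C real) \<Rightarrow> (real \<Rightarrow>\<^sub>C real)" where
  "T_b v = to_bcontfun (T (to_C01 v))"

definition P_b :: "(real \<Rightarrow>\<^sub>C real) set" where
  "P_b = {v \<in> clamped. \<forall>t\<in>{0..b}. \<sigma> * norm v \<le> apply_bcontfun v t}"

lemma T_b_clamped: "T_b v \<in> clamped"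
  unfolding T_b_def by (rule to_bcontfun_clamped[OF T_continuous[OF to_C01_mem]])

lemma T_b_apply: "t \<in> {0..1} \<Longrightarrow> apply_bcontfun (T_b v) t = T (to_C01 v) t"
  unfolding T_b_def apply_to_bcontfun[OF T_continuous[OF to_C01_mem]] by simp

lemma T_b_in_P_b: "T_b v \<in> P_b"
proof -
  have "\<sigma> * norm (T_b v) \<le> apply_bcontfun (T_b v) t" if t: "t \<in> {0..b}" for t
  proof -
    have "norm (T_b v) \<le> T (to_C01 v) t / \<sigma>"
      using T_cone_estimate[OF to_C01_mem t, of _ v] sigma3_pos
      by (intro clamped_norm_le[OF T_b_clamped])
         (simp add: T_b_apply pos_le_divide_eq mult.commute)
    then show ?thesis
      using sigma3_pos t b_less_1 by (simp add: T_b_apply pos_le_divide_eq mult.commute)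
  qed
  then show ?thesis
    by (simp add: P_b_def T_b_clamped)
qed

text \<open>
  The values of \<open>\<gamma>\<close> and of the kernel are bounded, so the distance of two images is bounded by the
  changes of \<open>H1\<close> and \<open>H2\<close> and the \<open>L\<^sup>1\<close>-distance of the superpositions \<open>f s (u s)\<close>. The latter
  tends to \<open>0\<close> by dominated convergence.
\<close>

lemma T_b_continuous: "continuous_on (cball 0 \<rho>) T_b"
proof (rule continuous_on_sequentiallyI)
  fix v :: "nat \<Rightarrow> real \<Rightarrow>\<^sub>C real" and l
  assume v: "\<forall>n. v n \<in> cball 0 \<rho>" and l: "l \<in> cball 0 \<rho>" and lim: "v \<longlonglongrightarrow> l"
  obtain F where F: "\<And>s x. s \<in> {0..1} \<Longrightarrow> \<bar>x\<bar> \<le> \<rho> \<Longrightarrow> f s x \<le> F"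
    using f_bounded by blast
  obtain M where M: "\<And>t s. t \<in> {0..1} \<Longrightarrow> s \<in> {0..1} \<Longrightarrow> \<bar>K t s\<bar> \<le> M"
    using K_bounded by blast
  define u where "u w s = f s (to_C01 w s)" for w s
  have u_cont: "continuous_on {0..1} (u w)" for w
    using to_C01_mem[of w] unfolding u_def mspace_C01 by (intro f_u_cont) blast
  have u_le: "0 \<le> u w s" "u w s \<le> F" if "w \<in> cball 0 \<rho>" "s \<in> {0..1}" for w s
    using that F[of s "to_C01 w s"] f_nonneg norm_bounded[of w s] by (auto simp: u_def to_C01_def)
  define E where "E n = \<bar>H1 (to_C01 (v n)) - H1 (to_C01 l)\<bar> * (\<bar>\<gamma> 0\<bar> / \<sigma>)
      + \<bar>H2 (to_C01 (v n)) - H2 (to_C01 l)\<bar> + M * integral {0..1} (\<lambda>s. \<bar>u (v n) s - u l s\<bar>)" for n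
  have "norm (T_b (v n) - T_b l) \<le> E n" for n
  proof (rule clamped_norm_le[OF clamped_diff[OF T_b_clamped T_b_clamped]])
    fix t :: real assume t: "t \<in> {0..1}"
    have "\<sigma> * \<bar>\<gamma> t\<bar> \<le> \<bar>\<gamma> 0\<bar>"
      using gamma_cone_estimate[of 0 t] t b \<eta> by simp
    then have \<gamma>: "\<bar>\<gamma> t\<bar> \<le> \<bar>\<gamma> 0\<bar> / \<sigma>"
      using sigma3_pos by (simp add: pos_le_divide_eq mult.commute)
    have int: "(\<lambda>s. K t s * u w s) integrable_on {0..1}" for w
      by (intro integrable_continuous_interval continuous_on_mult K_cont u_cont)
    have "\<bar>integral {0..1} (\<lambda>s. K t s * u (v n) s - K t s * u l s)\<bar>
        \<le> integral {0..1} (\<lambda>s. M * \<bar>u (v n) s - u l s\<bar>)"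
      unfolding real_norm_def[symmetric]
    proof (rule integral_norm_bound_integral)
      show "(\<lambda>s. M * norm (u (v n) s - u l s)) integrable_on {0..1}"
        by (intro integrable_continuous_interval continuous_intros u_cont)
      show "norm (K t s * u (v n) s - K t s * u l s) \<le> M * norm (u (v n) s - u l s)" if "s \<in> {0..1}" for s
        using M[OF t that] by (simp add: right_diff_distrib[symmetric] abs_mult mult_right_mono)
    qed (intro integrable_diff int)
    then have "\<bar>integral {0..1} (\<lambda>s. K t s * u (v n) s) - integral {0..1} (\<lambda>s. K t s * u l s)\<bar>
        \<le> M * integral {0..1} (\<lambda>s. \<bar>u (v n) s - u l s\<bar>)"
      by (simp add: integral_diff int)
    moreover have "\<bar>(H1 (to_C01 (v n)) - H1 (to_C01 l)) * \<gamma> t\<bar>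
        \<le> \<bar>H1 (to_C01 (v n)) - H1 (to_C01 l)\<bar> * (\<bar>\<gamma> 0\<bar> / \<sigma>)"
      unfolding abs_mult using \<gamma> by (intro mult_left_mono) auto
    moreover have "apply_bcontfun (T_b (v n) - T_b l) t = (H1 (to_C01 (v n)) - H1 (to_C01 l)) * \<gamma> t
        + (H2 (to_C01 (v n)) - H2 (to_C01 l))
        + (integral {0..1} (\<lambda>s. K t s * u (v n) s) - integral {0..1} (\<lambda>s. K t s * u l s))"
      using t by (simp add: T_b_apply T_op_def u_def left_diff_distrib)
    ultimately show "\<bar>apply_bcontfun (T_b (v n) - T_b l) t\<bar> \<le> E n"
      unfolding E_def by linarith
  qed
  moreover have "E \<longlonglongrightarrow> 0"
  proof -
    have H: "(\<lambda>n. \<bar>H (to_C01 (v n)) - H (to_C01 l)\<bar>) \<longlonglongrightarrow> 0" if "compact_functional H" for H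
      using continuous_on_tendsto_compose[OF compact_functional_continuous[OF that, of UNIV] lim]
      by (simp add: LIM_zero tendsto_rabs_zero)
    have "(\<lambda>n. integral {0..1} (\<lambda>s. \<bar>u (v n) s - u l s\<bar>)) \<longlonglongrightarrow> integral {0..1} (\<lambda>s::real. 0::real)"
    proof (rule dominated_convergence)
      show "(\<lambda>s. \<bar>u (v n) s - u l s\<bar>) integrable_on {0..1}" for n
        by (intro integrable_continuous_interval continuous_intros u_cont)
      show "norm \<bar>u (v n) s - u l s\<bar> \<le> F" if "s \<in> {0..1}" for n s
        using u_le[OF v[rule_format] that, of n] u_le[OF l that] by (simp add: abs_le_iff)
      show "(\<lambda>n. \<bar>u (v n) s - u l s\<bar>) \<longlonglongrightarrow> 0" if s: "s \<in> {0..1}" for s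
      proof -
        have "(\<lambda>n. to_C01 (v n) s) \<longlonglongrightarrow> to_C01 l s"
          using tendsto_apply_bcontfun[OF lim, of s] s by (simp add: to_C01_def)
        then have "(\<lambda>n. (s, to_C01 (v n) s)) \<longlonglongrightarrow> (s, to_C01 l s)"
          by (intro tendsto_intros)
        then have "(\<lambda>n. u (v n) s) \<longlonglongrightarrow> u l s"
          using continuous_on_tendsto_compose[OF f_cont] s by (force simp: u_def)
        then show ?thesis
          by (simp add: LIM_zero tendsto_rabs_zero)
      qed
    qed auto
    then have "E \<longlonglongrightarrow> 0 * (\<bar>\<gamma> 0\<bar> / \<sigma>) + 0 + M * 0"
      unfolding E_def by (intro tendsto_intros H H1 H2) simp
    then show ?thesis by simp
  qed
  ultimately have "(\<lambda>n. T_b (v n) - T_b l) \<longlonglongrightarrow> 0"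
    by (rule Lim_null_comparison[OF always_eventually[OF allI]])
  then show "(\<lambda>n. T_b (v n)) \<longlonglongrightarrow> T_b l"
    by (simp add: LIM_zero_iff)
qed

text \<open>
  The images of a ball are bounded and share a modulus of continuity. By the cone estimate it is
  enough to bound them at \<open>t = 0\<close>.
\<close>

lemma T_b_compact:
  obtains C where "compact C" "T_b ` cball 0 \<rho> \<subseteq> C"
proof -
  obtain F where F: "\<And>s x. s \<in> {0..1} \<Longrightarrow> \<bar>x\<bar> \<le> \<rho> \<Longrightarrow> f s x \<le> F"
    using f_bounded by blast
  obtain A where A: "\<And>v. norm v \<le> \<rho> \<Longrightarrow> \<bar>H1 (to_C01 v)\<bar> \<le> A"
    using compact_functional_bounded[OF H1(1)] by blast
  obtain B where B: "\<And>v. norm v \<le> \<rho> \<Longrightarrow> \<bar>H2 (to_C01 v)\<bar> \<le> B"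
    using compact_functional_bounded[OF H2(1)] by blast
  obtain M where M: "\<And>t s. t \<in> {0..1} \<Longrightarrow> s \<in> {0..1} \<Longrightarrow> \<bar>K t s\<bar> \<le> M"
    using K_bounded by blast
  define \<omega> where "\<omega> h = A * h + F * tpow (\<alpha> - 1) h / Gamma \<alpha>" for h
  define R where "R = (A * \<bar>\<gamma> 0\<bar> + B + M * F) / \<sigma>"
  define C where "C = {v \<in> clamped. norm v \<le> R \<and>
    (\<forall>s\<in>{0..1}. \<forall>t\<in>{0..1}. \<bar>apply_bcontfun v s - apply_bcontfun v t\<bar> \<le> \<omega> \<bar>s - t\<bar>)}"
  have "compact C"
    unfolding C_def using modulus_tendsto_0 by (intro compact_equicontinuous_clamped) (simp add: \<omega>_def)
  moreover have "T_b v \<in> C" if "v \<in> cball 0 \<rho>" for v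
  proof -
    have v: "norm v \<le> \<rho>"
      using that by simp
    have fv: "f s (to_C01 v s) \<le> F" if "s \<in> {0..1}" for s
      using F[OF that, of "to_C01 v s"] v norm_bounded[of v s] that by (simp add: to_C01_def)
    have cont: "continuous_on {0..1} (to_C01 v)"
      using to_C01_mem[of v] unfolding mspace_C01 by blast
    have zero: "0 \<in> {0..b}" "(0::real) \<in> {0..1}"
      using b \<eta> by auto
    have "norm (integral {0..1} (\<lambda>s. K 0 s * f s (to_C01 v s))) \<le> integral {0..1} (\<lambda>s::real. M * F)"
    proof (rule integral_norm_bound_integral)
      fix s :: real assume s: "s \<in> {0..1}"
      have "\<bar>K 0 s\<bar> * \<bar>f s (to_C01 v s)\<bar> \<le> M * F"
        using M[OF zero(2) s] fv[OF s] f_nonneg[OF s] by (intro mult_mono) auto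
      then show "norm (K 0 s * f s (to_C01 v s)) \<le> M * F"
        by (simp add: abs_mult)
    qed (use K_f_integrable[OF cont] in auto)
    moreover have "H1 (to_C01 v) * \<gamma> 0 \<le> A * \<bar>\<gamma> 0\<bar>"
      using A[OF v] gamma_nonneg[OF zero(1)] by (intro mult_mono) auto
    ultimately have "T (to_C01 v) 0 \<le> A * \<bar>\<gamma> 0\<bar> + B + M * F"
      using B[OF v] unfolding T_op_def by simp
    moreover have "\<sigma> * norm (T_b v) \<le> T (to_C01 v) 0"
      using T_b_in_P_b[of v] zero(1) unfolding P_b_def T_b_apply[OF zero(2), symmetric] by blast
    ultimately have "norm (T_b v) \<le> R"
      unfolding R_def using sigma3_pos by (simp add: pos_le_divide_eq mult.commute)
    moreover have "\<bar>apply_bcontfun (T_b v) s - apply_bcontfun (T_b v) t\<bar> \<le> \<omega> \<bar>s - t\<bar>"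
      if "s \<in> {0..1}" "t \<in> {0..1}" for s t
    proof -
      have "\<bar>T (to_C01 v) s - T (to_C01 v) t\<bar>
          \<le> H1 (to_C01 v) * \<bar>s - t\<bar> + F * tpow (\<alpha> - 1) \<bar>s - t\<bar> / Gamma \<alpha>"
        by (rule T_modulus[OF to_C01_mem fv])
      also have "\<dots> \<le> \<omega> \<bar>s - t\<bar>"
        unfolding \<omega>_def using A[OF v] by (intro add_right_mono mult_right_mono) auto
      finally show ?thesis
        using that by (simp add: T_b_apply)
    qed
    ultimately show ?thesis
      by (simp add: C_def T_b_clamped)
  qed
  ultimately show thesis
    using that by blast
qed

lemma closed_P_b: "closed P_b"
proof -
  have "closed (clamped \<inter> (\<Inter>t\<in>{0..b}. {v. \<sigma> * norm v \<le> apply_bcontfun v t}))"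
    by (intro closed_Int closed_clamped closed_INT ballI closed_Collect_le continuous_intros
        continuous_on_apply_at)
  moreover have "\<dots> = P_b"
    unfolding P_b_def by blast
  ultimately show ?thesis by simp
qed

lemma cone_P_b: "cone P_b"
  using sigma3_pos
  by (auto simp: cone_def P_b_def clamped_def mult.left_commute mult_left_mono)

lemma convex_P_b: "convex P_b"
proof (rule convexI)
  fix v w :: "real \<Rightarrow>\<^sub>C real" and p q :: real
  assume vw: "v \<in> P_b" "w \<in> P_b" and pq: "0 \<le> p" "0 \<le> q" "p + q = 1"
  have "\<sigma> * norm (p *\<^sub>R v + q *\<^sub>R w) \<le> apply_bcontfun (p *\<^sub>R v + q *\<^sub>R w) t" if "t \<in> {0..b}" for t
  proof -
    have "\<sigma> * norm (p *\<^sub>R v + q *\<^sub>R w) \<le> \<sigma> * (p * norm v + q * norm w)"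
      using pq sigma3_pos by (intro mult_left_mono norm_triangle_le) auto
    also have "\<dots> = p * (\<sigma> * norm v) + q * (\<sigma> * norm w)"
      by (simp add: algebra_simps)
    also have "\<dots> \<le> p * apply_bcontfun v t + q * apply_bcontfun w t"
      using vw pq that by (intro add_mono mult_left_mono) (auto simp: P_b_def)
    finally show ?thesis by simp
  qed
  then show "p *\<^sub>R v + q *\<^sub>R w \<in> P_b"
    using vw by (auto simp: P_b_def clamped_def)
qed

lemma to_C01_cone:
  assumes "v \<in> P_b" "norm v = \<rho>"
  shows "to_C01 v \<in> cone_P b \<sigma> \<inter> boundary_Omega \<rho>"
proof -
  have "sup_norm (to_C01 v) = \<rho>"
    using assms by (simp add: P_b_def sup_norm_to_C01)
  moreover have "\<sigma> * \<rho> \<le> (INF t\<in>{0..b}. to_C01 v t)"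
    using assms b \<eta> b_less_1 by (intro cINF_greatest) (auto simp: P_b_def to_C01_def)
  ultimately show ?thesis
    unfolding cone_P_def boundary_Omega_def using to_C01_mem[of v] by blast
qed

end

section \<open>Existence of an eigenvalue and an eigenfunction\<close>

theorem theorem3p4:
  fixes \<alpha> \<beta> \<eta> b \<rho> \<eta>1 \<eta>2 :: real
    and f :: "real \<Rightarrow> real \<Rightarrow> real"
    and H1 H2 :: "(real \<Rightarrow> real) \<Rightarrow> real"
    and \<delta> :: "real \<Rightarrow> real"
  assumes "1 < \<alpha>" and "\<alpha> \<le> 2" and "0 < \<eta>" and "\<eta> < 1" and "0 < \<beta>"
    and "continuous_on ({0..1} \<times> UNIV) (\<lambda>(t, x). f t x)"
    and "\<And>t x. t \<in> {0..1} \<Longrightarrow> 0 \<le> f t x"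
    and "compact_functional H1" and "\<And>u. u \<in> mspace C01 \<Longrightarrow> 0 \<le> H1 u"
    and "compact_functional H2" and "\<And>u. u \<in> mspace C01 \<Longrightarrow> 0 \<le> H2 u"
    and "\<beta> < min (beta_K \<alpha> \<eta>) (beta_gamma \<alpha> \<eta>)"
    and "\<eta> \<le> b" and "b < t_star \<alpha> \<beta> \<eta>"
    and "0 < \<rho>"
    and "continuous_on {0..b} \<delta>" and "\<And>t. t \<in> {0..b} \<Longrightarrow> 0 \<le> \<delta> t"
    and "\<And>t x. t \<in> {0..b} \<Longrightarrow> x \<in> {sigma3 \<alpha> \<beta> \<eta> b * \<rho>..\<rho>} \<Longrightarrow> \<delta> t \<le> f t x"
    and "0 \<le> \<eta>1" and "0 \<le> \<eta>2"
    and "\<And>u. u \<in> cone_P b (sigma3 \<alpha> \<beta> \<eta> b) \<inter> boundary_Omega \<rho> \<Longrightarrow> \<eta>1 \<le> H1 u \<and> \<eta>2 \<le> H2 u"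
    and "gamma_fn \<alpha> \<beta> \<eta> 0 * \<eta>1 + \<eta>2 + integral {0..b} (\<lambda>s. K_fn \<alpha> \<beta> \<eta> 0 s * \<delta> s) > 0"
  shows "\<exists>l u. l > 0 \<and> u \<in> cone_P b (sigma3 \<alpha> \<beta> \<eta> b) \<inter> boundary_Omega \<rho>
            \<and> mild_solution \<alpha> \<beta> \<eta> f H1 H2 l u
            \<and> (\<forall>t\<in>{0..b}. sigma3 \<alpha> \<beta> \<eta> b * \<rho> \<le> u t \<and> u t \<le> \<rho>)"
proof -
  interpret bvp \<alpha> \<beta> \<eta> b f H1 H2
    by unfold_locales (fact assms)+
  have zero: "0 \<in> {0..b}" "(0::real) \<in> {0..1}"
    using b \<eta> by auto
  define d where "d = \<gamma> 0 * \<eta>1 + \<eta>2 + integral {0..b} (\<lambda>s. K 0 s * \<delta> s)"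
  have range: "\<sigma> * \<rho> \<le> to_C01 v t \<and> to_C01 v t \<le> \<rho>"
    if "v \<in> P_b \<inter> sphere 0 \<rho>" "t \<in> {0..b}" for v t
    using that b_less_1 norm_bounded[of v t] by (auto simp: P_b_def to_C01_def)
  have T_ge: "d \<le> apply_bcontfun (T_b v) 0" if v: "v \<in> P_b \<inter> sphere 0 \<rho>" for v
  proof -
    have "to_C01 v \<in> cone_P b \<sigma> \<inter> boundary_Omega \<rho>"
      using v by (intro to_C01_cone) auto
    then have "\<eta>1 \<le> H1 (to_C01 v)" "\<eta>2 \<le> H2 (to_C01 v)"
      using assms(21) by blast+
    moreover have "\<delta> s \<le> f s (to_C01 v s)" if "s \<in> {0..b}" for s
      using assms(18)[OF that] range[OF v that] by simp
    ultimately show ?thesis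
      unfolding d_def T_b_apply[OF zero(2)]
      by (intro T_lower to_C01_mem zero assms(16)) auto
  qed
  obtain C where C: "compact C" "T_b ` cball 0 \<rho> \<subseteq> C"
    using T_b_compact by blast
  \<comment> \<open>Evaluation at \<open>0\<close>, a point of \<open>{0..b}\<close>, is the functional that selects a base of the cone.\<close>
  have "\<bar>apply_bcontfun v 0\<bar> \<le> norm v" for v :: "real \<Rightarrow>\<^sub>C real"
    using norm_bounded[of v 0] by simp
  then have "bounded_linear (\<lambda>v. apply_bcontfun v (0::real) :: real)"
    by (intro bounded_linear_intro[of _ 1]) simp_all
  then obtain l v where l: "l > 0" and v: "v \<in> P_b \<inter> sphere 0 \<rho>" and eq: "v = l *\<^sub>R T_b v"
  proof (rule birkhoff_kellogg_cone[OF closed_P_b convex_P_b cone_P_b _ sigma3_pos])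
    show "\<sigma> * norm v \<le> apply_bcontfun v 0" if "v \<in> P_b" for v
      using that zero by (auto simp: P_b_def)
    have "norm (const_bcontfun 1 :: real \<Rightarrow>\<^sub>C real) \<le> 1"
      by (rule norm_bound) simp
    then have "\<sigma> * norm (const_bcontfun 1 :: real \<Rightarrow>\<^sub>C real) \<le> 1 * 1"
      using sigma3_le_1 by (intro mult_mono) auto
    then show "const_bcontfun 1 \<in> P_b"
      by (simp add: P_b_def clamped_def)
    show "const_bcontfun 1 \<noteq> (0 :: real \<Rightarrow>\<^sub>C real)"
      by (metis const_bcontfun.rep_eq zero_bcontfun.rep_eq zero_neq_one)
    show "continuous_on (P_b \<inter> sphere 0 \<rho>) T_b"
      by (rule continuous_on_subset[OF T_b_continuous[of \<rho>]]) auto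
    show "T_b ` (P_b \<inter> sphere 0 \<rho>) \<subseteq> P_b \<inter> C"
      using C(2) T_b_in_P_b by auto
    show "d > 0"
      using assms(22) by (simp add: d_def)
  qed (use T_ge C assms(15) in auto)
  have "to_C01 v t = l * T (to_C01 v) t" if "t \<in> {0..1}" for t
  proof -
    have "apply_bcontfun v t = apply_bcontfun (l *\<^sub>R T_b v) t"
      using eq by simp
    then show ?thesis
      using that by (simp add: T_b_apply to_C01_def)
  qed
  then have "mild_solution \<alpha> \<beta> \<eta> f H1 H2 l (to_C01 v)"
    unfolding mild_solution_def using to_C01_mem by blast
  moreover have "to_C01 v \<in> cone_P b \<sigma> \<inter> boundary_Omega \<rho>"
    using v by (intro to_C01_cone) auto
  ultimately show ?thesis
    using l range[OF v] by blast
qed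

end
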